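(* Let $n\geq 3$. Let $t:\mathbf{wB}_{n+1}\to\mathbb{Z}[t^{\pm1}]^{\times}$ be the one-dimensional representation with $\sigma_i\mapsto t$ and $\tau_i\mapsto 1$. Then the representation $t^{-1}\mathbf{LM}_{1}(t)$ of $\mathbf{wB}_n$ is equivalent to the Burau representation $Bur:\mathbf{wB}_n\to GL_n(\mathbb{Z}[t^{\pm1}])$.
   Context: The welded braid group $\mathbf{wB}_{n}$ is the group with generators $\sigma_{i},\tau_{i}$, $1\leq i\leq n-1$, and relations: (1) $\sigma_{i}\sigma_{k}=\sigma_{k}\sigma_{i}$, $\tau_{i}\tau_{k}=\tau_{k}\tau_{i}$ and $\sigma_{i}\tau_{k}=\tau_{k}\sigma_{i}$ if $|i-k|\geq 2$; (2) $\sigma_{i}\sigma_{i+1}\sigma_{i}=\sigma_{i+1}\sigma_{i}\sigma_{i+1}$ and $\tau_{i}\tau_{i+1}\tau_{i}=\tau_{i+1}\tau_{i}\tau_{i+1}$ for $1\leq i\leq n-2$; (3) $\tau_{i}^{2}=1$ for $1\leq i\leq n-1$; (4) $\tau_{i}\sigma_{i+1}\sigma_{i}=\sigma_{i+1}\sigma_{i}\tau_{i+1}$ and $\sigma_{i}\tau_{i+1}\tau_{i}=\tau_{i+1}\tau_{i}\sigma_{i+1}$ for $1\leq i\leq n-2$. Products are read from right to left (as composition of maps). The homomorphism $id_1*-:\mathbf{wB}_n\to\mathbf{wB}_{n+1}$ sends $\sigma_i\mapsto\sigma_{i+1}$, $\tau_i\mapsto\tau_{i+1}$. $\mathbf{F}_n=\langle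 x_1,\ldots,x_n\rangle$ is the free group. The Artin homomorphism $a_n:\mathbf{wB}_n\to\mathrm{Aut}(\mathbf{F}_n)$ sends $\sigma_i$ to the automorphism $x_i\mapsto x_{i+1}$, $x_{i+1}\mapsto x_{i+1}^{-1}x_ix_{i+1}$, $x_j\mapsto x_j$ for $j\notin\{i,i+1\}$, and $\tau_i$ to the automorphism exchanging $x_i$ and $x_{i+1}$ and fixing the other $x_j$. The morphism $\xi_{n,1}:\mathbf{F}_n\to\mathbf{wB}_{n+1}$ is defined by $x_i\mapsto(\tau_{i-1}\cdots\tau_2\tau_1)^{-1}(\sigma_i\tau_i)(\tau_{i-1}\cdots\tau_2\tau_1)$. It satisfies $(id_1*\lambda)\,\xi_{n,1}(x)=\xi_{n,1}(a_n(\lambda)(x))\,(id_1*\lambda)$ for all $\lambda\in\mathbf{wB}_n$, $x\in\mathbf{F}_n$. Let $\mathcal{I}_{\mathbf{F}_n}$ be the augmentation ideal of $\mathbb{Z}[\mathbf{F}_n]$, with the action of $\mathbf{wB}_n$ induced by $a_n$. For a representation $\rho:\mathbf{wB}_{n+1}\to\mathrm{Aut}(V)$, regard $V$ as an $\mathbf{F}_n$-module via $\rho\circ\xi_{n,1}$. The Long-Moody construction $\mathbf{LM}_1(\rho)$ is the representation of $\mathbf{wB}_n$ on $\mathcal{I}_{\mathbf{F}_n}\otimes_{\mathbb{Z}[\mathbf{F}_n]}V$ given by $$\mathbf{LM}_1(\rho)(\lambda)(i\otimes v)=a_n(\lambda)(i)\otimes\rho(id_1*\lambda)(v).$$ For an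 invertible element $r$ of a ring $R$ and a representation $\rho$ of $\mathbf{wB}_m$ over $R$, $r$ also denotes the one-dimensional representation $\sigma_i\mapsto r$, $\tau_i\mapsto1$, and $r\rho$ denotes $r\otimes_R\rho$. $Bur:\mathbf{wB}_n\to GL_n(\mathbb{Z}[t^{\pm1}])$ is given by $\sigma_{i}\mapsto Id_{i-1}\oplus\begin{pmatrix}0 & t\\ 1 & 1-t\end{pmatrix}\oplus Id_{n-i-1}$ and $\tau_{i}\mapsto Id_{i-1}\oplus\begin{pmatrix}0 & 1\\ 1 & 0\end{pmatrix}\oplus Id_{n-i-1}$. *)

theory Defs
  imports
    "HOL-Algebra.Free_Abelian_Groups"
    "HOL-Algebra.Bij"
    "Jordan_Normal_Form.VS_Connect"
begin

section \<open>Groups given by generators and relations\<close>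

text \<open>A word is a list of signed generators: \<open>(s, True)\<close> stands for \<open>s\<close> and \<open>(s, False)\<close>
  for \<open>s\<^sup>-\<^sup>1\<close>.  The list order is the order in which the product is written.\<close>

type_synonym 's word = "('s \<times> bool) list"

inductive_set word_cong :: "'s set \<Rightarrow> ('s word \<times> 's word) set \<Rightarrow> ('s word \<times> 's word) set"
  for S :: "'s set" and R :: "('s word \<times> 's word) set" where
  refl: "w \<in> lists (S \<times> UNIV) \<Longrightarrow> (w, w) \<in> word_cong S R"
| sym: "(v, w) \<in> word_cong S R \<Longrightarrow> (w, v) \<in> word_cong S R"
| trans: "(u, v) \<in> word_cong S R \<Longrightarrow> (v, w) \<in> word_cong S R \<Longrightarrow> (u, w) \<in> word_cong S R"
| cancel: "u \<in> lists (S \<times> UNIV) \<Longrightarrow> v \<in> lists (S \<times> UNIV) \<Longrightarrow> s \<in> S \<Longrightarrow>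
    (u @ [(s, b), (s, \<not> b)] @ v, u @ v) \<in> word_cong S R"
| relator: "u \<in> lists (S \<times> UNIV) \<Longrightarrow> v \<in> lists (S \<times> UNIV) \<Longrightarrow> (l, r) \<in> R \<Longrightarrow>
    (u @ l @ v, u @ r @ v) \<in> word_cong S R"

definition presented_group :: "'s set \<Rightarrow> ('s word \<times> 's word) set \<Rightarrow> 's word set monoid" where
  "presented_group S R =
    \<lparr>carrier = lists (S \<times> UNIV) // word_cong S R,
     monoid.mult = (\<lambda>X Y. \<Union>u\<in>X. \<Union>v\<in>Y. word_cong S R `` {u @ v}),
     one = word_cong S R `` {[]}\<rparr>"

definition pres_gen :: "'s set \<Rightarrow> ('s word \<times> 's word) set \<Rightarrow> 's \<Rightarrow> 's word set" where
  "pres_gen S R s = word_cong S R `` {[(s, True)]}"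

primrec word_eval :: "('h, 'b) monoid_scheme \<Rightarrow> ('s \<Rightarrow> 'h) \<Rightarrow> 's word \<Rightarrow> 'h" where
  "word_eval H f [] = \<one>\<^bsub>H\<^esub>"
| "word_eval H f (x # w) =
    (if snd x then f (fst x) else inv\<^bsub>H\<^esub> (f (fst x))) \<otimes>\<^bsub>H\<^esub> word_eval H f w"

text \<open>The homomorphism from a presented group to \<open>H\<close> with prescribed values \<open>f\<close> on the generators.
  When \<open>f\<close> respects the relations, all representatives of a class have the same value.\<close>

definition pres_lift :: "('h, 'b) monoid_scheme \<Rightarrow> ('s \<Rightarrow> 'h) \<Rightarrow> 's word set \<Rightarrow> 'h" where
  "pres_lift H f X = the_elem (word_eval H f ` X)"


section \<open>Free groups and welded braid groups\<close>

definition free_grp :: "nat \<Rightarrow> nat word set monoid" where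
  "free_grp n = presented_group {1..n} {}"

definition free_gen :: "nat \<Rightarrow> nat \<Rightarrow> nat word set" where
  "free_gen n = pres_gen {1..n} {}"

datatype wgen = WSigma nat | WTau nat

abbreviation sw :: "nat \<Rightarrow> wgen word" where "sw i \<equiv> [(WSigma i, True)]"
abbreviation tw :: "nat \<Rightarrow> wgen word" where "tw i \<equiv> [(WTau i, True)]"

definition welded_gens :: "nat \<Rightarrow> wgen set" where
  "welded_gens n = {WSigma i | i. 1 \<le> i \<and> i < n} \<union> {WTau i | i. 1 \<le> i \<and> i < n}"

definition welded_rels :: "nat \<Rightarrow> (wgen word \<times> wgen word) set" where
  "welded_rels n =
     (\<Union>i\<in>{1..<n}. \<Union>k\<in>{k\<in>{1..<n}. \<bar>int i - int k\<bar> \<ge> 2}.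
        {(sw i @ sw k, sw k @ sw i), (tw i @ tw k, tw k @ tw i), (sw i @ tw k, tw k @ sw i)})
   \<union> (\<Union>i\<in>{i. 1 \<le> i \<and> i + 1 < n}.
        {(sw i @ sw (i+1) @ sw i, sw (i+1) @ sw i @ sw (i+1)),
         (tw i @ tw (i+1) @ tw i, tw (i+1) @ tw i @ tw (i+1))})
   \<union> (\<Union>i\<in>{1..<n}. {(tw i @ tw i, [])})
   \<union> (\<Union>i\<in>{i. 1 \<le> i \<and> i + 1 < n}.
        {(tw i @ sw (i+1) @ sw i, sw (i+1) @ sw i @ tw (i+1)),
         (sw i @ tw (i+1) @ tw i, tw (i+1) @ tw i @ sw (i+1))})"

definition welded_braid :: "nat \<Rightarrow> wgen word set monoid" where
  "welded_braid n = presented_group (welded_gens n) (welded_rels n)"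

definition sigma :: "nat \<Rightarrow> nat \<Rightarrow> wgen word set" where
  "sigma n i = pres_gen (welded_gens n) (welded_rels n) (WSigma i)"

definition tau :: "nat \<Rightarrow> nat \<Rightarrow> wgen word set" where
  "tau n i = pres_gen (welded_gens n) (welded_rels n) (WTau i)"

text \<open>The homomorphism \<open>id\<^sub>1 * -\<close> from \<open>wB\<^sub>n\<close> to \<open>wB\<^sub>n\<^sub>+\<^sub>1\<close>.\<close>

definition shift :: "nat \<Rightarrow> wgen word set \<Rightarrow> wgen word set" where
  "shift n = pres_lift (welded_braid (n+1))
     (\<lambda>s. case s of WSigma i \<Rightarrow> sigma (n+1) (i+1) | WTau i \<Rightarrow> tau (n+1) (i+1))"

definition free_endo :: "nat \<Rightarrow> (nat \<Rightarrow> nat word set) \<Rightarrow> nat word set \<Rightarrow> nat word set" where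
  "free_endo n f = restrict (pres_lift (free_grp n) f) (carrier (free_grp n))"

text \<open>The product in \<^const>\<open>AutoGroup\<close> is composition of maps, the right factor being applied first.\<close>

definition artin :: "nat \<Rightarrow> wgen word set \<Rightarrow> nat word set \<Rightarrow> nat word set" where
  "artin n = pres_lift (AutoGroup (free_grp n))
     (\<lambda>s. case s of
        WSigma i \<Rightarrow> free_endo n (\<lambda>j.
          if j = i then free_gen n (i+1)
          else if j = i + 1 then
            inv\<^bsub>free_grp n\<^esub> (free_gen n (i+1)) \<otimes>\<^bsub>free_grp n\<^esub> free_gen n i \<otimes>\<^bsub>free_grp n\<^esub> free_gen n (i+1)
          else free_gen n j)
      | WTau i \<Rightarrow> free_endo n (\<lambda>j.
          if j = i then free_gen n (i+1)
          else if j = i + 1 then free_gen n i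
          else free_gen n j))"

text \<open>\<open>tau_desc m k\<close> is \<open>\<tau>\<^sub>k \<cdots> \<tau>\<^sub>2 \<tau>\<^sub>1\<close> in \<open>wB\<^sub>m\<close>.\<close>

primrec tau_desc :: "nat \<Rightarrow> nat \<Rightarrow> wgen word set" where
  "tau_desc m 0 = \<one>\<^bsub>welded_braid m\<^esub>"
| "tau_desc m (Suc k) = tau m (Suc k) \<otimes>\<^bsub>welded_braid m\<^esub> tau_desc m k"

definition xi :: "nat \<Rightarrow> nat word set \<Rightarrow> wgen word set" where
  "xi n = pres_lift (welded_braid (n+1))
     (\<lambda>i. inv\<^bsub>welded_braid (n+1)\<^esub> (tau_desc (n+1) (i-1)) \<otimes>\<^bsub>welded_braid (n+1)\<^esub>
          (sigma (n+1) i \<otimes>\<^bsub>welded_braid (n+1)\<^esub> tau (n+1) i) \<otimes>\<^bsub>welded_braid (n+1)\<^esub>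
          tau_desc (n+1) (i-1))"


section \<open>Integral group rings\<close>

definition group_ring :: "('g, 'b) monoid_scheme \<Rightarrow> ('g \<Rightarrow>\<^sub>0 int) ring" where
  "group_ring G =
    \<lparr>carrier = {a. Poly_Mapping.keys a \<subseteq> carrier G},
     monoid.mult = (\<lambda>a b. frag_extend (\<lambda>g. frag_extend (\<lambda>h. frag_of (g \<otimes>\<^bsub>G\<^esub> h)) b) a),
     one = frag_of \<one>\<^bsub>G\<^esub>,
     zero = 0,
     add = (+)\<rparr>"

definition augmentation :: "('g \<Rightarrow>\<^sub>0 int) \<Rightarrow> int" where
  "augmentation a = (\<Sum>g\<in>Poly_Mapping.keys a. Poly_Mapping.lookup a g)"

definition augmentation_ideal :: "('g, 'b) monoid_scheme \<Rightarrow> ('g \<Rightarrow>\<^sub>0 int) set" where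
  "augmentation_ideal G = {a \<in> carrier (group_ring G). augmentation a = 0}"

text \<open>The action of \<open>\<int>[G]\<close> on the abelian group \<open>V\<close> extending an action \<open>\<phi>\<close> of \<open>G\<close>.\<close>

definition group_ring_act ::
  "('r, 'v, 'b) module_scheme \<Rightarrow> ('g \<Rightarrow> 'v \<Rightarrow> 'v) \<Rightarrow> ('g \<Rightarrow>\<^sub>0 int) \<Rightarrow> 'v \<Rightarrow> 'v" where
  "group_ring_act V \<phi> a v =
     (\<Oplus>\<^bsub>V\<^esub>g\<in>Poly_Mapping.keys a. [Poly_Mapping.lookup a g] \<cdot>\<^bsub>V\<^esub> (\<phi> g v))"


section \<open>Tensor products\<close>

text \<open>\<open>M \<otimes>\<^sub>A N\<close> for a right \<open>A\<close>-module \<open>M\<close> with action \<open>ra x a = x a\<close> and a left \<open>A\<close>-module \<open>N\<close> with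
  action \<open>la a v = a v\<close>: the free abelian group on pairs modulo the usual relations.
  The scalars of the module record \<open>N\<close>, which are assumed to commute with \<open>la\<close>, act on the tensor
  product through the second factor.  The fields \<open>mult\<close> and \<open>one\<close> play no role in a module.\<close>

definition tensor_rel :: "('a, 'b) ring_scheme \<Rightarrow> ('m, 'c) ring_scheme \<Rightarrow> ('m \<Rightarrow> 'a \<Rightarrow> 'm) \<Rightarrow>
    ('n, 'd) ring_scheme \<Rightarrow> ('a \<Rightarrow> 'n \<Rightarrow> 'n) \<Rightarrow> ('m \<times> 'n \<Rightarrow>\<^sub>0 int) set" where
  "tensor_rel A M ra N la = generate (free_Abelian_group (carrier M \<times> carrier N))
    ({frag_of (x \<oplus>\<^bsub>M\<^esub> y, v) - frag_of (x, v) - frag_of (y, v) | x y v.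
        x \<in> carrier M \<and> y \<in> carrier M \<and> v \<in> carrier N}
   \<union> {frag_of (x, v \<oplus>\<^bsub>N\<^esub> w) - frag_of (x, v) - frag_of (x, w) | x v w.
        x \<in> carrier M \<and> v \<in> carrier N \<and> w \<in> carrier N}
   \<union> {frag_of (ra x a, v) - frag_of (x, la a v) | x a v.
        x \<in> carrier M \<and> a \<in> carrier A \<and> v \<in> carrier N})"

definition tensor_group :: "('a, 'b) ring_scheme \<Rightarrow> ('m, 'c) ring_scheme \<Rightarrow> ('m \<Rightarrow> 'a \<Rightarrow> 'm) \<Rightarrow>
    ('n, 'd) ring_scheme \<Rightarrow> ('a \<Rightarrow> 'n \<Rightarrow> 'n) \<Rightarrow> ('m \<times> 'n \<Rightarrow>\<^sub>0 int) set monoid" where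
  "tensor_group A M ra N la =
     free_Abelian_group (carrier M \<times> carrier N) Mod tensor_rel A M ra N la"

text \<open>The endomorphism of \<open>M \<otimes>\<^sub>A N\<close> sending \<open>x \<otimes> v\<close> to \<open>f x \<otimes> g v\<close>, for \<open>f\<close>, \<open>g\<close> for which this is
  well-defined.\<close>

definition tensor_map :: "('a, 'b) ring_scheme \<Rightarrow> ('m, 'c) ring_scheme \<Rightarrow> ('m \<Rightarrow> 'a \<Rightarrow> 'm) \<Rightarrow>
    ('n, 'd) ring_scheme \<Rightarrow> ('a \<Rightarrow> 'n \<Rightarrow> 'n) \<Rightarrow> ('m \<Rightarrow> 'm) \<Rightarrow> ('n \<Rightarrow> 'n) \<Rightarrow>
    ('m \<times> 'n \<Rightarrow>\<^sub>0 int) set \<Rightarrow> ('m \<times> 'n \<Rightarrow>\<^sub>0 int) set" where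
  "tensor_map A M ra N la f g =
     (\<lambda>X\<in>carrier (tensor_group A M ra N la).
        the_elem ((\<lambda>c. tensor_rel A M ra N la #>\<^bsub>free_Abelian_group (carrier M \<times> carrier N)\<^esub>
                        frag_extend (\<lambda>(x, v). frag_of (f x, g v)) c) ` X))"

definition tensor_module :: "('a, 'b) ring_scheme \<Rightarrow> ('m, 'c) ring_scheme \<Rightarrow> ('m \<Rightarrow> 'a \<Rightarrow> 'm) \<Rightarrow>
    ('r, 'n, 'd) module_scheme \<Rightarrow> ('a \<Rightarrow> 'n \<Rightarrow> 'n) \<Rightarrow> ('r, ('m \<times> 'n \<Rightarrow>\<^sub>0 int) set) module" where
  "tensor_module A M ra N la =
    \<lparr>carrier = carrier (tensor_group A M ra N la),
     monoid.mult = undefined,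
     one = undefined,
     zero = \<one>\<^bsub>tensor_group A M ra N la\<^esub>,
     add = monoid.mult (tensor_group A M ra N la),
     smult = (\<lambda>r. tensor_map A M ra N la (\<lambda>x. x) (\<lambda>v. r \<odot>\<^bsub>N\<^esub> v))\<rparr>"


section \<open>Representations\<close>

text \<open>A representation is given by its underlying module together with the action.\<close>

type_synonym ('r, 'v, 'g) repr = "('r, 'v) module \<times> ('g \<Rightarrow> 'v \<Rightarrow> 'v)"

definition linear_auts :: "('r, 'a) ring_scheme \<Rightarrow> ('r, 'v) module \<Rightarrow> ('v \<Rightarrow> 'v) monoid" where
  "linear_auts R V =
     (BijGroup (carrier V))\<lparr>carrier := LinearCombinations.module_hom R V V \<inter> Bij (carrier V)\<rparr>"

definition is_repr :: "('g, 'b) monoid_scheme \<Rightarrow> ('r, 'a) ring_scheme \<Rightarrow> ('r, 'v, 'g) repr \<Rightarrow> bool" where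
  "is_repr G R = (\<lambda>(V, \<rho>). group G \<and> Module.module R V \<and> \<rho> \<in> hom G (linear_auts R V))"

definition equivalent_reprs :: "('g, 'b) monoid_scheme \<Rightarrow> ('r, 'a) ring_scheme \<Rightarrow>
    ('r, 'v, 'g) repr \<Rightarrow> ('r, 'w, 'g) repr \<Rightarrow> bool" where
  "equivalent_reprs G R = (\<lambda>(V, \<rho>) (W, \<psi>).
     is_repr G R (V, \<rho>) \<and> is_repr G R (W, \<psi>) \<and>
     (\<exists>\<phi>. \<phi> \<in> LinearCombinations.module_hom R V W \<and> bij_betw \<phi> (carrier V) (carrier W) \<and>
          (\<forall>g\<in>carrier G. \<forall>v\<in>carrier V. \<phi> (\<rho> g v) = \<psi> g (\<phi> v))))"

definition tensor_repr :: "('r, 'a) ring_scheme \<Rightarrow> ('r, 'v, 'g) repr \<Rightarrow> ('r, 'w, 'g) repr \<Rightarrow>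
    ('r, ('v \<times> 'w \<Rightarrow>\<^sub>0 int) set, 'g) repr" where
  "tensor_repr R = (\<lambda>(V, \<rho>) (W, \<psi>).
     (tensor_module R V (\<lambda>v r. r \<odot>\<^bsub>V\<^esub> v) W (\<lambda>r w. r \<odot>\<^bsub>W\<^esub> w),
      \<lambda>g. tensor_map R V (\<lambda>v r. r \<odot>\<^bsub>V\<^esub> v) W (\<lambda>r w. r \<odot>\<^bsub>W\<^esub> w) (\<rho> g) (\<psi> g)))"

definition regular_module :: "('r, 'a) ring_scheme \<Rightarrow> ('r, 'r) module" where
  "regular_module R =
    \<lparr>carrier = carrier R, monoid.mult = monoid.mult R, one = one R, zero = zero R, add = add R,
     smult = monoid.mult R\<rparr>"

text \<open>The one-dimensional representation of the welded braid groups given by a unit \<open>r\<close>.\<close>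

definition unit_char :: "('r, 'a) ring_scheme \<Rightarrow> 'r \<Rightarrow> wgen word set \<Rightarrow> 'r" where
  "unit_char R r =
     pres_lift (units_of R) (\<lambda>s. case s of WSigma i \<Rightarrow> r | WTau i \<Rightarrow> \<one>\<^bsub>R\<^esub>)"

definition unit_repr :: "('r, 'a) ring_scheme \<Rightarrow> 'r \<Rightarrow> ('r, 'r, wgen word set) repr" where
  "unit_repr R r = (regular_module R, \<lambda>g. \<lambda>v\<in>carrier R. unit_char R r g \<otimes>\<^bsub>R\<^esub> v)"

definition twist :: "('r, 'a) ring_scheme \<Rightarrow> 'r \<Rightarrow> ('r, 'v, wgen word set) repr \<Rightarrow>
    ('r, ('r \<times> 'v \<Rightarrow>\<^sub>0 int) set, wgen word set) repr" where
  "twist R r \<rho> = tensor_repr R (unit_repr R r) \<rho>"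


section \<open>The Long-Moody construction\<close>

definition long_moody :: "nat \<Rightarrow> ('r, 'v, wgen word set) repr \<Rightarrow>
    ('r, ((nat word set \<Rightarrow>\<^sub>0 int) \<times> 'v \<Rightarrow>\<^sub>0 int) set, wgen word set) repr" where
  "long_moody n = (\<lambda>(V, \<rho>).
     let A = group_ring (free_grp n);
         I = A\<lparr>carrier := augmentation_ideal (free_grp n)\<rparr>;
         act = group_ring_act V (\<lambda>x. \<rho> (xi n x))
     in (tensor_module A I (\<lambda>i a. i \<otimes>\<^bsub>A\<^esub> a) V act,
         \<lambda>g. tensor_map A I (\<lambda>i a. i \<otimes>\<^bsub>A\<^esub> a) V act
                (frag_extend (\<lambda>x. frag_of (artin n g x))) (\<rho> (shift n g))))"


section \<open>The Burau representation\<close>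

text \<open>The Laurent polynomial ring \<open>\<int>[t\<^sup>\<plusminus>\<^sup>1]\<close>: finitely supported coefficient functions on the
  exponents, with the convolution product.\<close>

type_synonym laurent = "int \<Rightarrow>\<^sub>0 int"

abbreviation laurent_ring :: "laurent ring" where
  "laurent_ring \<equiv> class_ring"

definition tvar :: laurent where
  "tvar = Poly_Mapping.single 1 1"

definition burau_gen :: "nat \<Rightarrow> wgen \<Rightarrow> laurent mat" where
  "burau_gen n s = (case s of
     WSigma i \<Rightarrow> diag_block_mat
       [1\<^sub>m (i - 1), mat_of_rows_list 2 [[0, tvar], [1, 1 - tvar]], 1\<^sub>m (n - i - 1)]
   | WTau i \<Rightarrow> diag_block_mat
       [1\<^sub>m (i - 1), mat_of_rows_list 2 [[0, 1], [1, 0]], 1\<^sub>m (n - i - 1)])"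

definition burau_mat :: "nat \<Rightarrow> wgen word set \<Rightarrow> laurent mat" where
  "burau_mat n = pres_lift (units_of (ring_mat TYPE(laurent) n ())) (burau_gen n)"

text \<open>Matrices act on column vectors from the left.\<close>

definition burau :: "nat \<Rightarrow> (laurent, laurent vec, wgen word set) repr" where
  "burau n = (module_vec TYPE(laurent) n, \<lambda>g. \<lambda>v\<in>carrier_vec n. burau_mat n g *\<^sub>v v)"

end

theory Submission
  imports Defs
begin

text \<open>The augmentation ideal of \<open>\<int>[F\<^sub>n]\<close> is a free right module on the elements \<open>x\<^sub>i - 1\<close>, and the
  coordinates of \<open>w - 1\<close> in this basis are the Fox derivatives of \<open>w\<close>.  Every \<open>x\<^sub>i\<close> acts on the
  representation \<open>t\<close> as multiplication by \<open>t\<close>, so the Long-Moody module is free of rank \<open>n\<close>, with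
  coordinates given by the Fox derivatives evaluated at \<open>x\<^sub>i = t\<close>.  By the chain rule,
  a braid acts in these coordinates by the Fox Jacobian of its Artin automorphism times the
  scalar by which it acts in the representation \<open>t\<close>.  The Jacobians of the generators are the
  Burau matrices, and the twist by \<open>t\<^sup>-\<^sup>1\<close> removes the scalar.  That the Burau matrices
  satisfy the welded braid relations is a consequence of the same chain rule.\<close>

section \<open>Groups given by generators and relations\<close>

text \<open>The tensor products are literal quotients of free abelian groups and their maps are read
  off from cosets, so not even the module axioms hold in advance. All of this is drawn from
  coordinates: a biadditive balanced map into Laurent vectors, together with a normal form modulo
  the relations, identifies the tensor product with column vectors. Module axioms, well-definedness
  of maps and the group action are then pulled back from matrices. The same argument serves twice,
  for the Long-Moody module and for the outer twist. Freeness of the augmentation ideal enters only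
  in its tensored form; the normal form rests on x y - 1 = (x - 1) y + (y - 1). The chain rule
  survives the evaluation at t because Artin automorphisms send each generator to a conjugate of a
  generator, which leaves the evaluation unchanged. The Burau entry 1 - t is the derivative of
  x_{i+1}^-1 x_i x_{i+1} by x_{i+1}: the last letter gives 1, the first one -t^-1 t^2.\<close>

declare in_lists_conv_set [simp del] in_listsD [rule del] in_listsI [rule del]

text \<open>Relators over \<open>S\<close> keep the congruence inside the words over
  \<open>S\<close>, so that it is an equivalence relation on that set.\<close>

locale presentation =
  fixes S :: "'s set" and R :: "('s word \<times> 's word) set"
  assumes rels: "R \<subseteq> lists (S \<times> UNIV) \<times> lists (S \<times> UNIV)"
begin

abbreviation G where "G \<equiv> presented_group S R"
abbreviation cl where "cl w \<equiv> word_cong S R `` {w}"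
abbreviation gen where "gen \<equiv> pres_gen S R"

lemma word_cong_in_lists:
  assumes "(v, w) \<in> word_cong S R"
  shows "v \<in> lists (S \<times> UNIV) \<and> w \<in> lists (S \<times> UNIV)"
  using assms rels by induction auto

lemma equiv_word_cong: "equiv (lists (S \<times> UNIV)) (word_cong S R)"
proof (rule equivI)
  show "word_cong S R \<subseteq> lists (S \<times> UNIV) \<times> lists (S \<times> UNIV)"
    using word_cong_in_lists by (auto simp: subset_iff)
  show "refl_on (lists (S \<times> UNIV)) (word_cong S R)"
    by (auto simp: refl_on_def intro: word_cong.refl)
  show "sym_on UNIV (word_cong S R)"
    by (auto simp: sym_def intro: word_cong.sym)
  show "trans_on UNIV (word_cong S R)"
    by (auto intro: transI word_cong.trans)
qed

lemma word_cong_append_both: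
  assumes "(v, w) \<in> word_cong S R" "a \<in> lists (S \<times> UNIV)" "b \<in> lists (S \<times> UNIV)"
  shows "(a @ v @ b, a @ w @ b) \<in> word_cong S R"
  using assms
proof induction
  case (refl w)
  then show ?case by (intro word_cong.refl) auto
next
  case (sym v w)
  then show ?case by (blast intro: word_cong.sym)
next
  case (trans u v w)
  then show ?case by (blast intro: word_cong.trans)
next
  case (cancel u v s c)
  then show ?case using word_cong.cancel[of "a @ u" S "v @ b" s c R] by simp
next
  case (relator u v l r)
  then show ?case using word_cong.relator[of "a @ u" S "v @ b" l r R] by simp
qed

lemma word_cong_append:
  assumes "(u, u') \<in> word_cong S R" "(v, v') \<in> word_cong S R"
  shows "(u @ v, u' @ v') \<in> word_cong S R"
proof (rule word_cong.trans)
  show "(u @ v, u' @ v) \<in> word_cong S R"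
    using word_cong_append_both[OF assms(1), of "[]" v] word_cong_in_lists[OF assms(2)] by simp
  show "(u' @ v, u' @ v') \<in> word_cong S R"
    using word_cong_append_both[OF assms(2), of u' "[]"] word_cong_in_lists[OF assms(1)] by simp
qed

lemma cl_eq_iff:
  assumes "v \<in> lists (S \<times> UNIV)" "w \<in> lists (S \<times> UNIV)"
  shows "cl v = cl w \<longleftrightarrow> (v, w) \<in> word_cong S R"
  using eq_equiv_class_iff[OF equiv_word_cong assms] .

lemma carrier_presented_group: "carrier G = cl ` lists (S \<times> UNIV)"
  by (auto simp: presented_group_def quotient_def)

lemma cl_in_carrier [simp, intro]: "w \<in> lists (S \<times> UNIV) \<Longrightarrow> cl w \<in> carrier G"
  by (simp add: carrier_presented_group)

text \<open>The product is a union over all representatives. Compatibility with concatenation makes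
  the united classes equal, and both index sets are nonempty, so the union is that one
  class.\<close>

lemma mult_cl:
  assumes "v \<in> lists (S \<times> UNIV)" "w \<in> lists (S \<times> UNIV)"
  shows "cl v \<otimes>\<^bsub>G\<^esub> cl w = cl (v @ w)"
proof -
  have eq: "cl (v' @ w') = cl (v @ w)" if "v' \<in> cl v" "w' \<in> cl w" for v' w'
  proof (rule equiv_class_eq[OF equiv_word_cong, symmetric])
    show "(v @ w, v' @ w') \<in> word_cong S R"
      using that by (intro word_cong_append) auto
  qed
  have "v \<in> cl v" "w \<in> cl w"
    using assms by (auto intro: word_cong.refl)
  then have ne: "cl v \<noteq> {}" "cl w \<noteq> {}" by blast+
  have "(\<Union>v'\<in>cl v. \<Union>w'\<in>cl w. cl (v' @ w')) = (\<Union>v'\<in>cl v. \<Union>w'\<in>cl w. cl (v @ w))"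
    by (rule SUP_cong[OF HOL.refl SUP_cong[OF HOL.refl eq]])
  also have "\<dots> = cl (v @ w)"
    by (simp only: UN_constant ne if_False)
  finally show ?thesis by (simp add: presented_group_def)
qed

lemma one_presented_group: "\<one>\<^bsub>G\<^esub> = cl []"
  by (simp add: presented_group_def)

lemma cl_cancel: "s \<in> S \<Longrightarrow> cl [(s, b), (s, \<not> b)] = cl []"
  using word_cong.cancel[of "[]" S "[]" s b R] by (subst cl_eq_iff) auto

lemma group_presented_group: "group G"
proof (rule groupI)
  fix x y assume "x \<in> carrier G" "y \<in> carrier G"
  then show "x \<otimes>\<^bsub>G\<^esub> y \<in> carrier G"
    by (auto simp: carrier_presented_group mult_cl)
next
  fix x y z assume "x \<in> carrier G" "y \<in> carrier G" "z \<in> carrier G"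
  then show "x \<otimes>\<^bsub>G\<^esub> y \<otimes>\<^bsub>G\<^esub> z = x \<otimes>\<^bsub>G\<^esub> (y \<otimes>\<^bsub>G\<^esub> z)"
    by (auto simp: carrier_presented_group mult_cl)
next
  fix x assume "x \<in> carrier G"
  then show "\<one>\<^bsub>G\<^esub> \<otimes>\<^bsub>G\<^esub> x = x"
    by (auto simp: carrier_presented_group mult_cl one_presented_group)
next
  fix x assume "x \<in> carrier G"
  then obtain w where w: "w \<in> lists (S \<times> UNIV)" and x: "x = cl w"
    by (auto simp: carrier_presented_group)
  \<comment> \<open>The left inverse grows letter by letter: the opposite of the new first letter is
    appended to an inverse of \<open>w\<close>, and the two letters cancel in the middle.\<close>
  have "\<exists>v\<in>lists (S \<times> UNIV). cl v \<otimes>\<^bsub>G\<^esub> cl w = cl []"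
    using w
  proof (induction w)
    case Nil
    then show ?case by (auto simp: mult_cl intro: bexI[of _ "[]"])
  next
    case (Cons a w)
    obtain s b where a: "a = (s, b)" by fastforce
    obtain v where v: "v \<in> lists (S \<times> UNIV)" "cl v \<otimes>\<^bsub>G\<^esub> cl w = cl []"
      using Cons by auto
    have s: "s \<in> S" and w: "w \<in> lists (S \<times> UNIV)" using Cons a by auto
    have "cl (v @ [(s, \<not> b), (s, \<not> \<not> b)] @ w) = cl (v @ w)"
      using s v w word_cong.cancel[of v S w s "\<not> b" R] by (subst cl_eq_iff) auto
    then have "cl (v @ [(s, \<not> b)]) \<otimes>\<^bsub>G\<^esub> cl (a # w) = cl []"
      using s v w a by (simp add: mult_cl)
    then show ?case using v s by (intro bexI[of _ "v @ [(s, \<not> b)]"]) auto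
  qed
  then show "\<exists>y\<in>carrier G. y \<otimes>\<^bsub>G\<^esub> x = \<one>\<^bsub>G\<^esub>"
    using x by (auto simp: one_presented_group)
qed (auto simp: one_presented_group)

sublocale group G by (rule group_presented_group)

lemma gen_in_carrier [simp, intro]: "s \<in> S \<Longrightarrow> gen s \<in> carrier G"
  by (auto simp: pres_gen_def)

lemma cl_inv_gen: "s \<in> S \<Longrightarrow> cl [(s, False)] = inv\<^bsub>G\<^esub> (gen s)"
  using cl_cancel[of s False] cl_cancel[of s True]
  by (intro inv_equality[symmetric]) (auto simp: pres_gen_def mult_cl one_presented_group)

lemma cl_Cons:
  assumes "s \<in> S" "w \<in> lists (S \<times> UNIV)"
  shows "cl ((s, b) # w) = (if b then gen s else inv\<^bsub>G\<^esub> (gen s)) \<otimes>\<^bsub>G\<^esub> cl w"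
proof -
  have "cl ((s, b) # w) = cl [(s, b)] \<otimes>\<^bsub>G\<^esub> cl w"
    using assms by (subst mult_cl) auto
  then show ?thesis
    using assms cl_inv_gen[of s] by (cases b) (auto simp: pres_gen_def)
qed

lemma presented_induct [consumes 1, case_names one gen inv]:
  assumes "x \<in> carrier G"
    and "P \<one>\<^bsub>G\<^esub>"
    and "\<And>s y. s \<in> S \<Longrightarrow> y \<in> carrier G \<Longrightarrow> P y \<Longrightarrow> P (gen s \<otimes>\<^bsub>G\<^esub> y)"
    and "\<And>s y. s \<in> S \<Longrightarrow> y \<in> carrier G \<Longrightarrow> P y \<Longrightarrow> P (inv\<^bsub>G\<^esub> (gen s) \<otimes>\<^bsub>G\<^esub> y)"
  shows "P x"
proof -
  obtain w where w: "w \<in> lists (S \<times> UNIV)" and x: "x = cl w"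
    using assms(1) by (auto simp: carrier_presented_group)
  have "P (cl w)" using w
    by (induction w) (use assms(2-4) in \<open>auto simp: cl_Cons one_presented_group\<close>)
  then show ?thesis by (simp add: x)
qed

lemma the_elem_image_cl:
  assumes "\<And>v. (w, v) \<in> word_cong S R \<Longrightarrow> f v = f w" and "w \<in> lists (S \<times> UNIV)"
  shows "the_elem (f ` cl w) = f w"
proof -
  have "f ` cl w = {f w}" using assms by (auto intro: word_cong.refl)
  then show ?thesis by simp
qed

lemma word_eval_hom:
  assumes "group H" "h \<in> hom G H" "\<And>s. s \<in> S \<Longrightarrow> f s = h (gen s)" "w \<in> lists (S \<times> UNIV)"
  shows "word_eval H f w = h (cl w)"
proof -
  interpret h: group_hom G H h
    using assms by (simp add: group_hom_def group_hom_axioms_def is_group)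
  show ?thesis using assms(4)
    by (induction w) (use assms(3) in \<open>auto simp: cl_Cons simp flip: one_presented_group\<close>)
qed

text \<open>A homomorphism with the prescribed values already forces them to respect the relations,
  so the lift is identified without checking a single relator. This is how the Burau matrices are
  treated later.\<close>

lemma pres_lift_eq_hom:
  assumes "group H" "h \<in> hom G H" "\<And>s. s \<in> S \<Longrightarrow> f s = h (gen s)" "x \<in> carrier G"
  shows "pres_lift H f x = h x"
proof -
  obtain w where w: "w \<in> lists (S \<times> UNIV)" and x: "x = cl w"
    using assms(4) by (auto simp: carrier_presented_group)
  have eq: "word_eval H f v = h (cl v)" if "v \<in> lists (S \<times> UNIV)" for v
    using assms that word_eval_hom by blast
  have "the_elem (word_eval H f ` cl w) = word_eval H f w"
  proof (rule the_elem_image_cl)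
    fix v assume "(w, v) \<in> word_cong S R"
    then show "word_eval H f v = word_eval H f w"
      using eq w word_cong_in_lists cl_eq_iff by metis
  qed (rule w)
  then show ?thesis by (simp add: pres_lift_def x eq w)
qed

lemma hom_unique:
  assumes "group H" "h \<in> hom G H" "k \<in> hom G H" "\<And>s. s \<in> S \<Longrightarrow> h (gen s) = k (gen s)"
    "x \<in> carrier G"
  shows "h x = k x"
  using pres_lift_eq_hom[of H h "\<lambda>s. h (gen s)" x] pres_lift_eq_hom[of H k "\<lambda>s. h (gen s)" x] assms
  by simp

lemma word_eval_closed:
  assumes "group H" "\<And>s. s \<in> S \<Longrightarrow> f s \<in> carrier H" "w \<in> lists (S \<times> UNIV)"
  shows "word_eval H f w \<in> carrier H"
proof -
  interpret H: group H by fact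
  show ?thesis using assms(3)
    by (induction w) (use assms(2) in auto)
qed

lemma word_eval_append:
  assumes "group H" "\<And>s. s \<in> S \<Longrightarrow> f s \<in> carrier H" "v \<in> lists (S \<times> UNIV)" "w \<in> lists (S \<times> UNIV)"
  shows "word_eval H f (v @ w) = word_eval H f v \<otimes>\<^bsub>H\<^esub> word_eval H f w"
proof -
  interpret H: group H by fact
  note cl = word_eval_closed[where H = H and f = f, OF assms(1,2)]
  show ?thesis using assms(3)
    by (induction v) (use assms(2,4) cl in \<open>auto simp: H.m_assoc\<close>)
qed

lemma word_eval_cong:
  assumes "group H" "\<And>s. s \<in> S \<Longrightarrow> f s \<in> carrier H"
    "\<And>l r. (l, r) \<in> R \<Longrightarrow> word_eval H f l = word_eval H f r"
    "(v, w) \<in> word_cong S R"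
  shows "word_eval H f v = word_eval H f w"
  using assms(4)
proof induction
  interpret H: group H by fact
  note app = word_eval_append[where H = H and f = f, OF assms(1,2)]
  note closed = word_eval_closed[where H = H and f = f, OF assms(1,2)]
  {
    case (cancel u v s b)
    have "word_eval H f ([(s, b), (s, \<not> b)] @ v) = word_eval H f v"
      using cancel closed assms(2) by (cases b) (auto simp flip: H.m_assoc)
    then show ?case using cancel app[of u "[(s, b), (s, \<not> b)] @ v"] app[of u v] by auto
  next
    case (relator u v l r)
    then have "l \<in> lists (S \<times> UNIV)" "r \<in> lists (S \<times> UNIV)" using rels by auto
    then show ?case using relator by (simp add: app assms(3))
  }
qed auto

text \<open>Von Dyck's theorem: values that satisfy the relators extend to a homomorphism.\<close>

lemma
  assumes "group H" "\<And>s. s \<in> S \<Longrightarrow> f s \<in> carrier H"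
    "\<And>l r. (l, r) \<in> R \<Longrightarrow> word_eval H f l = word_eval H f r"
  shows pres_lift_cl: "w \<in> lists (S \<times> UNIV) \<Longrightarrow> pres_lift H f (cl w) = word_eval H f w"
    and pres_lift_hom: "pres_lift H f \<in> hom G H"
    and pres_lift_gen: "s \<in> S \<Longrightarrow> pres_lift H f (gen s) = f s"
proof -
  interpret H: group H by fact
  show cl: "pres_lift H f (cl w) = word_eval H f w" if "w \<in> lists (S \<times> UNIV)" for w
    unfolding pres_lift_def
    by (rule the_elem_image_cl) (use that word_eval_cong[OF assms] in auto)
  show "pres_lift H f \<in> hom G H"
  proof (rule homI)
    show "pres_lift H f x \<in> carrier H" if "x \<in> carrier G" for x
      using that word_eval_closed[OF assms(1,2)] by (auto simp: carrier_presented_group cl)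
    show "pres_lift H f (x \<otimes>\<^bsub>G\<^esub> y) = pres_lift H f x \<otimes>\<^bsub>H\<^esub> pres_lift H f y"
      if "x \<in> carrier G" "y \<in> carrier G" for x y
      using that by (auto simp: carrier_presented_group cl mult_cl word_eval_append[OF assms(1,2)])
  qed
  show "pres_lift H f (gen s) = f s" if "s \<in> S"
    using cl[of "[(s, True)]"] that assms(2) by (simp add: pres_gen_def)
qed

end

section \<open>The Artin homomorphism\<close>

interpretation F: presentation "{1..n}" "{} :: (nat word \<times> nat word) set"
  rewrites "presented_group {1..n} {} = free_grp n" and "pres_gen {1..n} {} = free_gen n" for n
  by unfold_locales (auto simp: free_grp_def free_gen_def)

interpretation W: presentation "welded_gens n" "welded_rels n"
  rewrites "presented_group (welded_gens n) (welded_rels n) = welded_braid n" for n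
  by unfold_locales (auto simp: welded_gens_def welded_rels_def welded_braid_def)

lemma gen_welded: "pres_gen (welded_gens n) (welded_rels n) (WSigma i) = sigma n i"
  "pres_gen (welded_gens n) (welded_rels n) (WTau i) = tau n i"
  by (simp_all add: sigma_def tau_def)

lemma free_gen_closed [simp]: "1 \<le> i \<Longrightarrow> i \<le> n \<Longrightarrow> free_gen n i \<in> carrier (free_grp n)"
  by auto

lemma free_endo_hom:
  assumes "\<And>i. i \<in> {1..n} \<Longrightarrow> f i \<in> carrier (free_grp n)"
  shows "free_endo n f \<in> hom (free_grp n) (free_grp n)"
    and "free_endo n f \<in> extensional (carrier (free_grp n))"
    and "i \<in> {1..n} \<Longrightarrow> free_endo n f (free_gen n i) = f i"
proof -
  have "pres_lift (free_grp n) f \<in> hom (free_grp n) (free_grp n)"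
    by (rule F.pres_lift_hom) (use assms in auto)
  then show "free_endo n f \<in> hom (free_grp n) (free_grp n)"
    by (auto simp: free_endo_def hom_def)
  show "free_endo n f \<in> extensional (carrier (free_grp n))"
    by (simp add: free_endo_def)
  show "free_endo n f (free_gen n i) = f i" if "i \<in> {1..n}"
    using that F.pres_lift_gen[of "free_grp n" n f i] assms by (simp add: free_endo_def)
qed

lemma free_hom_ext:
  assumes "\<alpha> \<in> hom (free_grp n) (free_grp n)" "\<alpha> \<in> extensional (carrier (free_grp n))"
    and "\<beta> \<in> hom (free_grp n) (free_grp n)" "\<beta> \<in> extensional (carrier (free_grp n))"
    and "\<And>j. j \<in> {1..n} \<Longrightarrow> \<alpha> (free_gen n j) = \<beta> (free_gen n j)"
  shows "\<alpha> = \<beta>"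
  by (rule extensionalityI[OF assms(2,4)], rule F.hom_unique[OF F.is_group assms(1,3)])
    (use assms(5) in auto)

text \<open>Both composites are homomorphisms that agree with the identity on the generators, hence
  on the whole free group.\<close>

lemma free_autoI:
  assumes "\<alpha> \<in> hom (free_grp n) (free_grp n)" "\<alpha> \<in> extensional (carrier (free_grp n))"
    and "\<beta> \<in> hom (free_grp n) (free_grp n)"
    and "\<And>j. j \<in> {1..n} \<Longrightarrow> \<alpha> (\<beta> (free_gen n j)) = free_gen n j"
    and "\<And>j. j \<in> {1..n} \<Longrightarrow> \<beta> (\<alpha> (free_gen n j)) = free_gen n j"
  shows "\<alpha> \<in> auto (free_grp n)"
proof -
  have id: "(\<lambda>x. x) \<in> hom (free_grp n) (free_grp n)" by (simp add: hom_def)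
  have "\<alpha> (\<beta> x) = x" if "x \<in> carrier (free_grp n)" for x
    using F.hom_unique[OF F.is_group hom_compose[OF assms(3,1)] id _ that] assms(4) by simp
  moreover have "\<beta> (\<alpha> x) = x" if "x \<in> carrier (free_grp n)" for x
    using F.hom_unique[OF F.is_group hom_compose[OF assms(1,3)] id _ that] assms(5) by simp
  ultimately have "bij_betw \<alpha> (carrier (free_grp n)) (carrier (free_grp n))"
    using assms(1,3) by (intro bij_betw_byWitness[where f' = \<beta>]) (auto simp: hom_def)
  then show ?thesis using assms by (simp add: auto_def Bij_def)
qed

text \<open>The assignment on generators inside \<open>artin\<close>, named so that the relations
  can be checked on it before \<open>artin\<close> is known to be a homomorphism.\<close>

definition artin_gen :: "nat \<Rightarrow> wgen \<Rightarrow> nat word set \<Rightarrow> nat word set" where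
  "artin_gen n s = (case s of
        WSigma i \<Rightarrow> free_endo n (\<lambda>j.
          if j = i then free_gen n (i+1)
          else if j = i + 1 then
            inv\<^bsub>free_grp n\<^esub> (free_gen n (i+1)) \<otimes>\<^bsub>free_grp n\<^esub> free_gen n i \<otimes>\<^bsub>free_grp n\<^esub> free_gen n (i+1)
          else free_gen n j)
      | WTau i \<Rightarrow> free_endo n (\<lambda>j.
          if j = i then free_gen n (i+1)
          else if j = i + 1 then free_gen n i
          else free_gen n j))"

lemma artin_eq: "artin n = pres_lift (AutoGroup (free_grp n)) (artin_gen n)"
  by (simp add: artin_def artin_gen_def[abs_def])

text \<open>Free reduction for products bracketed to the right. With associativity and the inverse
  of a product these rules carry out the word computations behind the relations.\<close>

lemma inv_cancel_left:
  assumes "x \<in> carrier (free_grp n)" "y \<in> carrier (free_grp n)"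
  shows "inv\<^bsub>free_grp n\<^esub> x \<otimes>\<^bsub>free_grp n\<^esub> (x \<otimes>\<^bsub>free_grp n\<^esub> y) = y"
    and "x \<otimes>\<^bsub>free_grp n\<^esub> (inv\<^bsub>free_grp n\<^esub> x \<otimes>\<^bsub>free_grp n\<^esub> y) = y"
  using assms by (simp_all flip: F.m_assoc)

context
  fixes n s
  assumes s: "s \<in> welded_gens n"
begin

lemma artin_gen_hom: "artin_gen n s \<in> hom (free_grp n) (free_grp n)"
  and artin_gen_extensional: "artin_gen n s \<in> extensional (carrier (free_grp n))"
  using s by (auto simp: artin_gen_def welded_gens_def intro!: free_endo_hom)

lemma artin_gen_closed:
    "x \<in> carrier (free_grp n) \<Longrightarrow> artin_gen n s x \<in> carrier (free_grp n)"
  and artin_gen_mult: "x \<in> carrier (free_grp n) \<Longrightarrow> y \<in> carrier (free_grp n) \<Longrightarrow>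
    artin_gen n s (x \<otimes>\<^bsub>free_grp n\<^esub> y) = artin_gen n s x \<otimes>\<^bsub>free_grp n\<^esub> artin_gen n s y"
  and artin_gen_inv: "x \<in> carrier (free_grp n) \<Longrightarrow>
    artin_gen n s (inv\<^bsub>free_grp n\<^esub> x) = inv\<^bsub>free_grp n\<^esub> (artin_gen n s x)"
proof -
  interpret group_hom "free_grp n" "free_grp n" "artin_gen n s"
    by unfold_locales (rule artin_gen_hom)
  show "x \<in> carrier (free_grp n) \<Longrightarrow> artin_gen n s x \<in> carrier (free_grp n)"
    and "x \<in> carrier (free_grp n) \<Longrightarrow> y \<in> carrier (free_grp n) \<Longrightarrow>
    artin_gen n s (x \<otimes>\<^bsub>free_grp n\<^esub> y) = artin_gen n s x \<otimes>\<^bsub>free_grp n\<^esub> artin_gen n s y"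
    and "x \<in> carrier (free_grp n) \<Longrightarrow>
    artin_gen n s (inv\<^bsub>free_grp n\<^esub> x) = inv\<^bsub>free_grp n\<^esub> (artin_gen n s x)"
    by simp_all
qed

end

lemma artin_gen_sigma:
  assumes "1 \<le> i" "i < n" "j \<in> {1..n}"
  shows "artin_gen n (WSigma i) (free_gen n j) =
    (if j = i then free_gen n (i+1)
     else if j = i + 1 then
       inv\<^bsub>free_grp n\<^esub> (free_gen n (i+1)) \<otimes>\<^bsub>free_grp n\<^esub> (free_gen n i \<otimes>\<^bsub>free_grp n\<^esub> free_gen n (i+1))
     else free_gen n j)"
  unfolding artin_gen_def wgen.case
  by (subst free_endo_hom(3)) (use assms in \<open>auto simp: F.m_assoc\<close>)

lemma artin_gen_tau:
  assumes "1 \<le> i" "i < n" "j \<in> {1..n}"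
  shows "artin_gen n (WTau i) (free_gen n j) =
    (if j = i then free_gen n (i+1) else if j = i + 1 then free_gen n i else free_gen n j)"
  unfolding artin_gen_def wgen.case
  by (subst free_endo_hom(3)) (use assms in auto)

lemma in_welded_gens [simp]:
  "WSigma i \<in> welded_gens n \<longleftrightarrow> 1 \<le> i \<and> i < n"
  "WTau i \<in> welded_gens n \<longleftrightarrow> 1 \<le> i \<and> i < n"
  by (auto simp: welded_gens_def)

lemmas artin_gen_simps =
  artin_gen_sigma artin_gen_tau artin_gen_mult artin_gen_inv artin_gen_closed
  F.m_assoc F.inv_mult_group inv_cancel_left

lemma artin_gen_auto:
  assumes "s \<in> welded_gens n"
  shows "artin_gen n s \<in> auto (free_grp n)"
proof (cases s)
  case (WSigma i)
  \<comment> \<open>The inverse of the automorphism of \<open>WSigma i\<close>, found by solving its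
    two defining equations for x_i and x_{i+1}.\<close>
  define \<beta> where "\<beta> = free_endo n (\<lambda>j. if j = i then
    free_gen n i \<otimes>\<^bsub>free_grp n\<^esub> (free_gen n (i+1) \<otimes>\<^bsub>free_grp n\<^esub> inv\<^bsub>free_grp n\<^esub> (free_gen n i))
    else if j = i + 1 then free_gen n i else free_gen n j)"
  have i: "1 \<le> i" "i < n" using assms WSigma by auto
  have \<beta>: "\<beta> \<in> hom (free_grp n) (free_grp n)"
    unfolding \<beta>_def by (rule free_endo_hom) (use i in auto)
  have \<beta>_gen: "\<beta> (free_gen n j) = (if j = i then
    free_gen n i \<otimes>\<^bsub>free_grp n\<^esub> (free_gen n (i+1) \<otimes>\<^bsub>free_grp n\<^esub> inv\<^bsub>free_grp n\<^esub> (free_gen n i))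
    else if j = i + 1 then free_gen n i else free_gen n j)" if "j \<in> {1..n}" for j
    unfolding \<beta>_def by (rule free_endo_hom) (use i that in auto)
  interpret \<beta>: group_hom "free_grp n" "free_grp n" \<beta>
    by unfold_locales (rule \<beta>)
  show ?thesis
  proof (rule free_autoI[OF _ _ \<beta>])
    fix j assume j: "j \<in> {1..n}"
    show "artin_gen n s (\<beta> (free_gen n j)) = free_gen n j"
      using i j WSigma by (auto simp: \<beta>_gen artin_gen_simps)
    show "\<beta> (artin_gen n s (free_gen n j)) = free_gen n j"
      using i j WSigma by (auto simp: \<beta>_gen artin_gen_simps)
  qed (use assms artin_gen_hom artin_gen_extensional in auto)
next
  case (WTau i)
  \<comment> \<open>The exchange of two generators is its own inverse.\<close>
  show ?thesis
    by (rule free_autoI[of _ _ "artin_gen n s"])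
      (use assms WTau in \<open>auto simp: artin_gen_simps intro: artin_gen_hom artin_gen_extensional\<close>)
qed

lemma group_AutoGroup: "group (AutoGroup (free_grp n))"
  by (rule F.AutoGroup)

lemma AutoGroup_simps:
  "carrier (AutoGroup G) = auto G"
  "\<one>\<^bsub>AutoGroup G\<^esub> = (\<lambda>x\<in>carrier G. x)"
  "\<alpha> \<in> auto G \<Longrightarrow> \<beta> \<in> auto G \<Longrightarrow> \<alpha> \<otimes>\<^bsub>AutoGroup G\<^esub> \<beta> = compose (carrier G) \<alpha> \<beta>"
  by (simp_all add: AutoGroup_def BijGroup_def auto_def)

lemma auto_free_ext:
  assumes "\<alpha> \<in> auto (free_grp n)" "\<beta> \<in> auto (free_grp n)"
    and "\<And>j. j \<in> {1..n} \<Longrightarrow> \<alpha> (free_gen n j) = \<beta> (free_gen n j)"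
  shows "\<alpha> = \<beta>"
  using assms by (intro free_hom_ext) (auto simp: auto_def Bij_def)

text \<open>Replaces the defining equation of \<open>word_eval\<close>, so that a relation becomes a
  comparison of iterated \<open>artin_gen\<close> at one point and products in the automorphism
  group never appear.\<close>

lemma word_eval_artin_Cons:
  assumes "s \<in> welded_gens n" "w \<in> lists (welded_gens n \<times> UNIV)" "x \<in> carrier (free_grp n)"
  shows "word_eval (AutoGroup (free_grp n)) (artin_gen n) ((s, True) # w) x =
    artin_gen n s (word_eval (AutoGroup (free_grp n)) (artin_gen n) w x)"
proof -
  have "word_eval (AutoGroup (free_grp n)) (artin_gen n) w \<in> auto (free_grp n)"
    using W.word_eval_closed[OF group_AutoGroup, of n "artin_gen n" n w] assms(2)
    by (simp add: AutoGroup_simps artin_gen_auto)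
  then show ?thesis
    using assms artin_gen_auto[of s n] by (simp add: AutoGroup_simps compose_def)
qed

lemma artin_relations:
  assumes "(l, r) \<in> welded_rels n"
  shows "word_eval (AutoGroup (free_grp n)) (artin_gen n) l = word_eval (AutoGroup (free_grp n)) (artin_gen n) r"
proof (rule auto_free_ext)
  have lr: "l \<in> lists (welded_gens n \<times> UNIV)" "r \<in> lists (welded_gens n \<times> UNIV)"
    using assms W.rels by auto
  then show "word_eval (AutoGroup (free_grp n)) (artin_gen n) l \<in> auto (free_grp n)"
    "word_eval (AutoGroup (free_grp n)) (artin_gen n) r \<in> auto (free_grp n)"
    using W.word_eval_closed[OF group_AutoGroup, of n "artin_gen n" n]
    by (simp_all add: AutoGroup_simps artin_gen_auto)
  fix j assume j: "j \<in> {1..n}"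
  let ?E = "\<lambda>w. word_eval (AutoGroup (free_grp n)) (artin_gen n) w (free_gen n j)"
  note simps = word_eval_artin_Cons AutoGroup_simps artin_gen_simps
  consider (comm) i k where "i \<in> {1..<n}" "k \<in> {k\<in>{1..<n}. \<bar>int i - int k\<bar> \<ge> 2}"
      "(l, r) \<in> {(sw i @ sw k, sw k @ sw i), (tw i @ tw k, tw k @ tw i), (sw i @ tw k, tw k @ sw i)}"
    | (braid) i where "i \<in> {i. 1 \<le> i \<and> i + 1 < n}"
      "(l, r) \<in> {(sw i @ sw (i+1) @ sw i, sw (i+1) @ sw i @ sw (i+1)),
         (tw i @ tw (i+1) @ tw i, tw (i+1) @ tw i @ tw (i+1))}"
    | (square) i where "i \<in> {1..<n}" "(l, r) \<in> {(tw i @ tw i, [])}"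
    | (mixed) i where "i \<in> {i. 1 \<le> i \<and> i + 1 < n}"
      "(l, r) \<in> {(tw i @ sw (i+1) @ sw i, sw (i+1) @ sw i @ tw (i+1)),
         (sw i @ tw (i+1) @ tw i, tw (i+1) @ tw i @ sw (i+1))}"
    using assms unfolding welded_rels_def by (elim UnE UN_E) (rule that, assumption+)+
  then show "?E l = ?E r"
  proof cases
    case comm
    \<comment> \<open>Distance at least two makes {i, i+1} and {k, k+1} disjoint; this is spelled
      out in both orientations for the case distinctions of \<open>artin_gen\<close>.\<close>
    have ne: "i \<noteq> k" "k \<noteq> i" "k \<noteq> Suc i" "Suc i \<noteq> k" "Suc k \<noteq> i" "i \<noteq> Suc k"
      using comm(2) by auto
    consider "j = i" | "j = i + 1" | "j = k" | "j = k + 1"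
      | "j \<noteq> i" "j \<noteq> i + 1" "j \<noteq> k" "j \<noteq> k + 1" by blast
    then have "?E (sw i @ sw k) = ?E (sw k @ sw i) \<and> ?E (tw i @ tw k) = ?E (tw k @ tw i)
      \<and> ?E (sw i @ tw k) = ?E (tw k @ sw i)"
      by cases (use j comm(1,2) ne in \<open>simp_all add: simps del: word_eval.simps(2)\<close>)
    then show ?thesis using comm(3) by auto
  next
    case braid
    consider "j = i" | "j = i + 1" | "j = i + 2"
      | "j \<noteq> i" "j \<noteq> i + 1" "j \<noteq> i + 2" by blast
    then have "?E (sw i @ sw (i+1) @ sw i) = ?E (sw (i+1) @ sw i @ sw (i+1)) \<and>
      ?E (tw i @ tw (i+1) @ tw i) = ?E (tw (i+1) @ tw i @ tw (i+1))"
      by cases (use j braid(1) in \<open>simp_all add: simps del: word_eval.simps(2)\<close>)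
    then show ?thesis using braid(2) by auto
  next
    case mixed
    consider "j = i" | "j = i + 1" | "j = i + 2"
      | "j \<noteq> i" "j \<noteq> i + 1" "j \<noteq> i + 2" by blast
    then have "?E (tw i @ sw (i+1) @ sw i) = ?E (sw (i+1) @ sw i @ tw (i+1)) \<and>
      ?E (sw i @ tw (i+1) @ tw i) = ?E (tw (i+1) @ tw i @ sw (i+1))"
      by cases (use j mixed(1) in \<open>simp_all add: simps del: word_eval.simps(2)\<close>)
    then show ?thesis using mixed(2) by auto
  next
    case square
    then show ?thesis
      using j by (simp add: simps del: word_eval.simps(2))
  qed
qed

lemma artin_hom: "artin n \<in> hom (welded_braid n) (AutoGroup (free_grp n))"
  and artin_gen_value: "s \<in> welded_gens n \<Longrightarrow>
    artin n (pres_gen (welded_gens n) (welded_rels n) s) = artin_gen n s"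
  unfolding artin_eq
  by (rule W.pres_lift_hom W.pres_lift_gen;
      auto simp: AutoGroup_simps artin_gen_auto group_AutoGroup artin_relations)+

section \<open>Fox calculus at \<open>t\<close>\<close>

abbreviation laurent_units :: "laurent monoid" where
  "laurent_units \<equiv> units_of laurent_ring"

definition tinv :: laurent where
  "tinv = Poly_Mapping.single (-1) 1"

lemma tvar_tinv [simp]: "tvar * tinv = 1" "tinv * tvar = 1"
  "tvar * (tinv * x) = x" "tinv * (tvar * x) = x"
proof -
  show t: "tvar * tinv = 1" "tinv * tvar = 1"
    by (simp_all add: tvar_def tinv_def mult_single)
  show "tvar * (tinv * x) = x" "tinv * (tvar * x) = x"
    by (simp_all add: t flip: mult.assoc)
qed

lemma group_laurent_units: "group laurent_units"
  by (rule monoid.units_group, unfold_locales) auto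

lemma Units_laurent: "x \<in> Units laurent_ring \<longleftrightarrow> (\<exists>y. x * y = 1)"
  by (auto simp: Units_def mult.commute)

lemma laurent_units_simps:
  "carrier laurent_units = Units laurent_ring" "\<one>\<^bsub>laurent_units\<^esub> = 1"
  "x \<otimes>\<^bsub>laurent_units\<^esub> y = x * y"
  by (simp_all add: units_of_def)

lemma inv_laurent_units:
  assumes "x * y = 1"
  shows "inv\<^bsub>laurent_units\<^esub> x = y"
  by (rule group.inv_equality[OF group_laurent_units])
    (use assms in \<open>auto simp: laurent_units_simps Units_laurent mult.commute\<close>)

lemma inv_tvar: "inv\<^bsub>laurent_units\<^esub> tvar = tinv"
  by (rule inv_laurent_units) simp

lemma tvar_Units [simp]: "tvar \<in> Units laurent_ring" and tinv_Units [simp]: "tinv \<in> Units laurent_ring"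
  unfolding Units_laurent by (rule exI tvar_tinv)+

lemma inv_laurent_tvar: "inv\<^bsub>laurent_ring\<^esub> tvar = tinv"
proof -
  have "monoid laurent_ring" by unfold_locales auto
  from monoid.units_of_inv[OF this tvar_Units] show ?thesis by (simp add: inv_tvar)
qed

text \<open>Both sides of every relation contain equally many letters \<open>WSigma\<close>, and the
  letters \<open>WTau\<close> count as 1.\<close>

lemma word_eval_unit_relations:
  assumes "r \<in> Units laurent_ring" "(l, r') \<in> welded_rels n"
  defines "f \<equiv> \<lambda>s. case s of WSigma i \<Rightarrow> r | WTau i \<Rightarrow> \<one>\<^bsub>laurent_ring\<^esub>"
  shows "word_eval laurent_units f l = word_eval laurent_units f r'"
  using assms(2) by (auto simp: welded_rels_def f_def laurent_units_simps)

lemma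
  assumes "r \<in> Units laurent_ring"
  shows unit_char_hom: "unit_char laurent_ring r \<in> hom (welded_braid n) laurent_units"
    and unit_char_sigma: "1 \<le> i \<Longrightarrow> i < n \<Longrightarrow> unit_char laurent_ring r (sigma n i) = r"
    and unit_char_tau: "1 \<le> i \<Longrightarrow> i < n \<Longrightarrow> unit_char laurent_ring r (tau n i) = 1"
proof -
  have closed: "(case s of WSigma i \<Rightarrow> r | WTau i \<Rightarrow> \<one>\<^bsub>laurent_ring\<^esub>) \<in> carrier laurent_units" for s
    using assms by (auto simp: laurent_units_simps Units_laurent split: wgen.splits)
  show "unit_char laurent_ring r \<in> hom (welded_braid n) laurent_units"
    unfolding unit_char_def
    by (rule W.pres_lift_hom[OF group_laurent_units closed word_eval_unit_relations[OF assms]])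
  note gen = W.pres_lift_gen[OF group_laurent_units closed word_eval_unit_relations[OF assms, where n = n]]
  show "1 \<le> i \<Longrightarrow> i < n \<Longrightarrow> unit_char laurent_ring r (sigma n i) = r"
    using gen[where s = "WSigma i"] by (simp add: unit_char_def gen_welded)
  show "1 \<le> i \<Longrightarrow> i < n \<Longrightarrow> unit_char laurent_ring r (tau n i) = 1"
    using gen[where s = "WTau i"] by (simp add: unit_char_def gen_welded)
qed

text \<open>Evaluation at x_i = t, the character through which the free group acts on the
  representation t (see \<open>unit_char_xi\<close>).\<close>

definition chi :: "nat \<Rightarrow> nat word set \<Rightarrow> laurent" where
  "chi n = pres_lift laurent_units (\<lambda>_. tvar)"

lemma chi_hom: "chi n \<in> hom (free_grp n) laurent_units"
  and chi_gen: "i \<in> {1..n} \<Longrightarrow> chi n (free_gen n i) = tvar"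
  unfolding chi_def
  by (rule F.pres_lift_hom F.pres_lift_gen;
      simp add: group_laurent_units laurent_units_simps)+

lemma chi_cl: "w \<in> lists ({1..n} \<times> UNIV) \<Longrightarrow>
    chi n (word_cong {1..n} {} `` {w}) = word_eval laurent_units (\<lambda>_. tvar) w"
  unfolding chi_def
  by (rule F.pres_lift_cl) (simp_all add: group_laurent_units laurent_units_simps)

lemma chi_mult: "x \<in> carrier (free_grp n) \<Longrightarrow> y \<in> carrier (free_grp n) \<Longrightarrow>
    chi n (x \<otimes>\<^bsub>free_grp n\<^esub> y) = chi n x * chi n y"
  using hom_mult[OF chi_hom] by (simp add: laurent_units_simps)

lemma chi_one: "chi n \<one>\<^bsub>free_grp n\<^esub> = 1"
  using hom_one[OF chi_hom F.is_group group_laurent_units] by (simp add: laurent_units_simps)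

lemma chi_mult_inv: "x \<in> carrier (free_grp n) \<Longrightarrow> chi n x * chi n (inv\<^bsub>free_grp n\<^esub> x) = 1"
  by (simp add: chi_one flip: chi_mult)

lemma chi_inv_gen: "i \<in> {1..n} \<Longrightarrow> chi n (inv\<^bsub>free_grp n\<^esub> (free_gen n i)) = tinv"
  using chi_mult_inv[of "free_gen n i" n] chi_gen[of i n]
  by (metis F.gen_in_carrier mult.right_neutral tvar_tinv(4))

text \<open>The convention is the one for right modules, \<open>\<partial>(u v) = \<partial>u \<cdot> v + \<partial>v\<close>.\<close>

primrec fox_word :: "nat \<Rightarrow> nat word \<Rightarrow> laurent" where
  "fox_word k [] = 0"
| "fox_word k (x # w) =
    (if fst x = k then (if snd x then 1 else - tinv) * word_eval laurent_units (\<lambda>_. tvar) w else 0)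
    + fox_word k w"

lemma word_eval_tvar_append: "word_eval laurent_units (\<lambda>_. tvar) (u @ v) =
    word_eval laurent_units (\<lambda>_. tvar) u * word_eval laurent_units (\<lambda>_. tvar) v"
  by (induction u) (auto simp: laurent_units_simps mult.assoc)

lemma fox_word_append:
  "fox_word k (u @ v) = fox_word k u * word_eval laurent_units (\<lambda>_. tvar) v + fox_word k v"
  by (induction u) (auto simp: word_eval_tvar_append algebra_simps)

text \<open>A cancelling pair contributes \<open>tinv - tinv\<close> or
  \<open>- tinv * tvar + 1\<close>, which is 0, and it evaluates to 1, so the terms of the letters
  before it do not change either.\<close>

lemma fox_word_cong:
  "(v, w) \<in> word_cong {1..n} {} \<Longrightarrow> fox_word k v = fox_word k w"
proof (induction rule: word_cong.induct)
  case (cancel u v s b)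
  then show ?case
    by (cases b)
      (simp_all add: fox_word_append word_eval_tvar_append laurent_units_simps inv_tvar
        flip: mult.assoc)
qed auto

definition fox :: "nat \<Rightarrow> nat \<Rightarrow> nat word set \<Rightarrow> laurent" where
  "fox n k X = the_elem (fox_word k ` X)"

lemma fox_cl: "w \<in> lists ({1..n} \<times> UNIV) \<Longrightarrow> fox n k (word_cong {1..n} {} `` {w}) = fox_word k w"
  unfolding fox_def by (rule F.the_elem_image_cl, rule fox_word_cong[symmetric])

lemma fox_mult:
  assumes "x \<in> carrier (free_grp n)" "y \<in> carrier (free_grp n)"
  shows "fox n k (x \<otimes>\<^bsub>free_grp n\<^esub> y) = fox n k x * chi n y + fox n k y"
  using assms
  by (auto simp: F.carrier_presented_group F.mult_cl fox_cl chi_cl fox_word_append simp del: One_nat_def)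

lemma fox_one: "fox n k \<one>\<^bsub>free_grp n\<^esub> = 0"
  by (simp add: F.one_presented_group fox_cl del: One_nat_def)

lemma fox_gen:
  assumes "i \<in> {1..n}"
  shows "fox n k (free_gen n i) = (if i = k then 1 else 0)"
  using assms fox_cl[of "[(i, True)]" n k]
  by (simp add: free_gen_def pres_gen_def laurent_units_simps)

lemma fox_inv:
  assumes "x \<in> carrier (free_grp n)"
  shows "fox n k (inv\<^bsub>free_grp n\<^esub> x) = - (fox n k x * chi n (inv\<^bsub>free_grp n\<^esub> x))"
  using fox_mult[of x n "inv\<^bsub>free_grp n\<^esub> x" k] assms by (simp add: fox_one eq_neg_iff_add_eq_0 add.commute)

definition fox_vec :: "nat \<Rightarrow> nat word set \<Rightarrow> laurent vec" where
  "fox_vec n x = vec n (\<lambda>i. fox n (Suc i) x)"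

text \<open>The Fox Jacobian with the images of the generators as columns, so that it acts on column
  vectors from the left. \<open>Suc\<close> translates matrix indices from 0 into generators from
  1.\<close>

definition fox_mat :: "nat \<Rightarrow> (nat word set \<Rightarrow> nat word set) \<Rightarrow> laurent mat" where
  "fox_mat n \<alpha> = mat n n (\<lambda>(i, j). fox n (Suc i) (\<alpha> (free_gen n (Suc j))))"

lemma fox_vec_carrier [simp]: "fox_vec n x \<in> carrier_vec n"
  by (simp add: fox_vec_def)

lemma fox_mat_carrier [simp]: "fox_mat n \<alpha> \<in> carrier_mat n n"
  by (simp add: fox_mat_def)

text \<open>Both sides obey the same product rule in \<open>x\<close> and agree on generators. The
  product rule for the left side produces the factor \<open>chi n (\<alpha> y)\<close>, which
  matches the factor \<open>chi n y\<close> on the right because \<open>\<alpha>\<close> preserves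
  \<open>chi\<close>.\<close>

lemma fox_chain:
  assumes \<alpha>: "\<alpha> \<in> hom (free_grp n) (free_grp n)"
    and chi: "\<And>x. x \<in> carrier (free_grp n) \<Longrightarrow> chi n (\<alpha> x) = chi n x"
    and x: "x \<in> carrier (free_grp n)"
  shows "fox n k (\<alpha> x) = (\<Sum>j<n. fox n k (\<alpha> (free_gen n (Suc j))) * fox n (Suc j) x)"
proof -
  interpret \<alpha>: group_hom "free_grp n" "free_grp n" \<alpha>
    by unfold_locales (rule \<alpha>)
  \<comment> \<open>The derivatives of a single generator are a Kronecker delta, so only the column
    \<open>s - 1\<close> survives in the sum.\<close>
  have pick: "(\<Sum>j<n. g j * (if s = Suc j then c else 0)) = g (s - 1) * c" if "s \<in> {1..n}"
    for s and c :: laurent and g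
  proof -
    have s: "s - 1 < n" using that by auto
    have "(\<Sum>j<n. g j * (if s = Suc j then c else 0)) = (\<Sum>j<n. if j = s - 1 then g j * c else 0)"
      using that by (intro sum.cong) auto
    also have "\<dots> = g (s - 1) * c" using s by simp
    finally show ?thesis .
  qed
  have fox_gen': "fox n (Suc j) (free_gen n s) * c = (if s = Suc j then c else 0)"
    if "s \<in> {1..n}" for s j c
    using that by (simp add: fox_gen)
  show ?thesis using x
  proof (induction x rule: F.presented_induct)
    case one
    then show ?case by (simp add: fox_one)
  next
    case (gen s y)
    then show ?case
      by (simp only: \<alpha>.hom_mult \<alpha>.hom_closed fox_mult F.gen_in_carrier chi fox_gen' pick
        distrib_left sum.distrib) simp
  next
    case (inv s y)
    then have s: "free_gen n s \<in> carrier (free_grp n)" by auto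
    have "chi n (inv\<^bsub>free_grp n\<^esub> (\<alpha> (free_gen n s))) = tinv"
      using s inv(1) chi[of "inv\<^bsub>free_grp n\<^esub> (free_gen n s)"] by (simp add: chi_inv_gen)
    then have lhs: "fox n k (\<alpha> (inv\<^bsub>free_grp n\<^esub> (free_gen n s) \<otimes>\<^bsub>free_grp n\<^esub> y)) =
        - (fox n k (\<alpha> (free_gen n s)) * (tinv * chi n y)) + fox n k (\<alpha> y)"
      using s inv(2) chi by (simp add: fox_mult fox_inv mult.assoc)
    have rhs: "fox n j (inv\<^bsub>free_grp n\<^esub> (free_gen n s) \<otimes>\<^bsub>free_grp n\<^esub> y) =
        - (if s = j then tinv * chi n y else 0) + fox n j y" for j
      using s inv(1,2) by (simp add: fox_mult fox_inv chi_inv_gen fox_gen)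
    show ?case
      unfolding lhs rhs distrib_left mult_minus_right sum.distrib sum_negf pick[OF inv(1)]
      using inv(1,3) by simp
  qed
qed

lemma fox_vec_chain:
  assumes "\<alpha> \<in> hom (free_grp n) (free_grp n)"
    and "\<And>x. x \<in> carrier (free_grp n) \<Longrightarrow> chi n (\<alpha> x) = chi n x"
    and "x \<in> carrier (free_grp n)"
  shows "fox_vec n (\<alpha> x) = fox_mat n \<alpha> *\<^sub>v fox_vec n x"
  by (rule eq_vecI)
    (auto simp: fox_vec_def fox_mat_def scalar_prod_def lessThan_atLeast0 fox_chain[OF assms])

lemma col_fox_mat: "j < n \<Longrightarrow> col (fox_mat n \<alpha>) j = fox_vec n (\<alpha> (free_gen n (Suc j)))"
  by (auto simp: fox_vec_def fox_mat_def)

text \<open>The chain rule for \<open>\<alpha>\<close>, applied to the elements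
  \<open>\<beta> (free_gen n (Suc j))\<close>, column by column.\<close>

lemma fox_mat_compose:
  assumes "\<alpha> \<in> hom (free_grp n) (free_grp n)"
    and "\<And>x. x \<in> carrier (free_grp n) \<Longrightarrow> chi n (\<alpha> x) = chi n x"
    and "\<beta> \<in> carrier (free_grp n) \<rightarrow> carrier (free_grp n)"
  shows "fox_mat n (\<lambda>x. \<alpha> (\<beta> x)) = fox_mat n \<alpha> * fox_mat n \<beta>"
proof (rule mat_col_eqI)
  fix j assume "j < dim_col (fox_mat n \<alpha> * fox_mat n \<beta>)"
  then have j: "j < n" by (simp add: fox_mat_def)
  then have "\<beta> (free_gen n (Suc j)) \<in> carrier (free_grp n)"
    using assms(3) by auto
  then show "col (fox_mat n (\<lambda>x. \<alpha> (\<beta> x))) j = col (fox_mat n \<alpha> * fox_mat n \<beta>) j"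
    using j by (subst col_mult2[of _ n n _ n]) (auto simp: col_fox_mat fox_vec_chain[OF assms(1,2)])
qed (auto simp: fox_mat_def)

lemma fox_mat_id:
  assumes "\<And>j. j \<in> {1..n} \<Longrightarrow> \<alpha> (free_gen n j) = free_gen n j"
  shows "fox_mat n \<alpha> = 1\<^sub>m n"
  by (rule eq_matI) (auto simp: fox_mat_def assms fox_gen)

section \<open>The Burau matrices as Fox Jacobians\<close>

context
  fixes n g
  assumes g: "g \<in> carrier (welded_braid n)"
begin

lemma artin_in_auto: "artin n g \<in> auto (free_grp n)"
  using hom_in_carrier[OF artin_hom g] by (simp add: AutoGroup_simps)

lemma artin_group_hom: "artin n g \<in> hom (free_grp n) (free_grp n)"
  using artin_in_auto by (simp add: auto_def)

lemma artin_closed: "x \<in> carrier (free_grp n) \<Longrightarrow> artin n g x \<in> carrier (free_grp n)"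
  using artin_group_hom by (auto simp: hom_def)

end

lemma artin_mult:
  assumes "g \<in> carrier (welded_braid n)" "h \<in> carrier (welded_braid n)" "x \<in> carrier (free_grp n)"
  shows "artin n (g \<otimes>\<^bsub>welded_braid n\<^esub> h) x = artin n g (artin n h x)"
  using hom_mult[OF artin_hom assms(1,2)] assms
  by (simp add: AutoGroup_simps artin_in_auto compose_def)

lemma artin_one: "x \<in> carrier (free_grp n) \<Longrightarrow> artin n \<one>\<^bsub>welded_braid n\<^esub> x = x"
  using hom_one[OF artin_hom W.is_group group_AutoGroup] by (simp add: AutoGroup_simps)

text \<open>Each generator goes to a conjugate of a generator, and conjugation is invisible in a
  commutative target.\<close>

lemma chi_artin_gen:
  assumes s: "s \<in> welded_gens n" and x: "x \<in> carrier (free_grp n)"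
  shows "chi n (artin_gen n s x) = chi n x"
proof -
  have "chi n (artin_gen n s (free_gen n j)) = tvar" if j: "j \<in> {1..n}" for j
    using s j by (cases s) (auto simp: artin_gen_simps chi_mult chi_gen chi_inv_gen)
  then have "(chi n \<circ> artin_gen n s) x = chi n x"
    by (intro F.hom_unique[OF group_laurent_units hom_compose[OF artin_gen_hom[OF s] chi_hom] chi_hom _ x])
      (simp add: chi_gen)
  then show ?thesis by simp
qed

lemma chi_artin:
  assumes "g \<in> carrier (welded_braid n)" "x \<in> carrier (free_grp n)"
  shows "chi n (artin n g x) = chi n x"
  using assms
proof (induction g arbitrary: x rule: W.presented_induct)
  case one
  then show ?case by (simp add: artin_one)
next
  case (gen s y)
  then show ?case by (simp add: artin_mult artin_closed artin_gen_value chi_artin_gen)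
next
  case (inv s y)
  let ?s = "pres_gen (welded_gens n) (welded_rels n) s"
  have "chi n (artin n (inv\<^bsub>welded_braid n\<^esub> ?s) z) = chi n z" if z: "z \<in> carrier (free_grp n)" for z
  proof -
    \<comment> \<open>The generator maps \<open>z'\<close> back to \<open>z\<close> and preserves
      \<open>chi\<close>; hence its inverse preserves \<open>chi\<close> too.\<close>
    define z' where "z' = artin n (inv\<^bsub>welded_braid n\<^esub> ?s) z"
    have "z' \<in> carrier (free_grp n)" using z inv(1) by (simp add: z'_def artin_closed)
    moreover have "artin_gen n s z' = z"
      using inv(1) z artin_mult[of ?s n "inv\<^bsub>welded_braid n\<^esub> ?s" z]
      by (simp add: z'_def artin_gen_value artin_one)
    ultimately show ?thesis using chi_artin_gen[OF inv(1), of z'] by (simp add: z'_def)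
  qed
  then show ?case using inv by (simp add: artin_mult artin_closed)
qed

lemma fox_mat_artin_mult:
  assumes "g \<in> carrier (welded_braid n)" "h \<in> carrier (welded_braid n)"
  shows "fox_mat n (artin n (g \<otimes>\<^bsub>welded_braid n\<^esub> h)) = fox_mat n (artin n g) * fox_mat n (artin n h)"
proof -
  have "fox_mat n (artin n (g \<otimes>\<^bsub>welded_braid n\<^esub> h)) = fox_mat n (\<lambda>x. artin n g (artin n h x))"
    by (rule eq_matI) (use assms in \<open>auto simp: fox_mat_def artin_mult\<close>)
  also have "\<dots> = fox_mat n (artin n g) * fox_mat n (artin n h)"
    by (rule fox_mat_compose) (use assms in \<open>auto simp: artin_group_hom chi_artin artin_closed\<close>)
  finally show ?thesis .
qed

abbreviation gl :: "nat \<Rightarrow> laurent mat monoid" where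
  "gl n \<equiv> units_of (ring_mat TYPE(laurent) n ())"

lemma group_gl: "group (gl n)"
proof -
  interpret ring "ring_mat TYPE(laurent) n ()" by (rule ring_mat)
  show ?thesis by (rule units_group)
qed

text \<open>The Magnus representation attached to \<open>chi\<close>: Jacobians multiply by the
  chain rule, and the inverse matrix is the Jacobian of the inverse braid.\<close>

lemma fox_mat_artin_hom: "(\<lambda>g. fox_mat n (artin n g)) \<in> hom (welded_braid n) (gl n)"
proof (rule homI)
  fix g assume g: "g \<in> carrier (welded_braid n)"
  have one: "fox_mat n (artin n \<one>\<^bsub>welded_braid n\<^esub>) = 1\<^sub>m n"
    by (rule fox_mat_id) (simp add: artin_one)
  have "fox_mat n (artin n (inv\<^bsub>welded_braid n\<^esub> g)) * fox_mat n (artin n g) = 1\<^sub>m n"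
    "fox_mat n (artin n g) * fox_mat n (artin n (inv\<^bsub>welded_braid n\<^esub> g)) = 1\<^sub>m n"
    using g by (simp_all add: one flip: fox_mat_artin_mult)
  then show "fox_mat n (artin n g) \<in> carrier (gl n)"
    by (auto simp: units_of_carrier Units_def ring_mat_simps intro!: bexI[of _ "fox_mat n (artin n (inv\<^bsub>welded_braid n\<^esub> g))"])
qed (simp add: fox_mat_artin_mult units_of_mult ring_mat_simps)

text \<open>Puts the nested block matrix into one entrywise formula, the shape in which Jacobian
  entries are computed.\<close>

lemma diag_block_mat_one_2x2_one:
  "diag_block_mat [1\<^sub>m m, mat_of_rows_list 2 [[a, b], [c, d]], 1\<^sub>m p] =
    mat (m + 2 + p) (m + 2 + p) (\<lambda>(i, j).
      if i = m then (if j = m then a else if j = Suc m then b else 0)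
      else if i = Suc m then (if j = m then c else if j = Suc m then d else 0)
      else if i = j then 1 else (0 :: 'a :: zero_neq_one))" (is "?A = ?B")
proof (rule eq_matI)
  fix i j assume "i < dim_row ?B" "j < dim_col ?B"
  then have ij: "i < m + 2 + p" "j < m + 2 + p" by simp_all
  have entry: "?A $$ (i, j) =
    (if i < m then if j < m then 1\<^sub>m m $$ (i, j) else 0
     else if j < m then 0
     else if i - m < 2 then if j - m < 2 then [[a, b], [c, d]] ! (i - m) ! (j - m) else 0
     else if j - m < 2 then 0 else 1\<^sub>m p $$ (i - m - 2, j - m - 2))"
    using ij by (simp add: Let_def mat_of_rows_list_def numeral_2_eq_2)
  consider "i < m" | "i = m" | "i = Suc m" | "m + 2 \<le> i"
    by linarith
  then show "?A $$ (i, j) = ?B $$ (i, j)"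
  proof cases
    case 4
    consider "j < m" | "j = m" | "j = Suc m" | "m + 2 \<le> j"
      by linarith
    then show ?thesis using ij 4 unfolding entry by cases auto
  qed (use ij in \<open>unfold entry, auto\<close>)
qed (simp_all add: mat_of_rows_list_def Let_def)

text \<open>For \<open>WSigma i\<close> the column of x_i is that of x_{i+1}, and the column of
  x_{i+1} holds the derivatives of x_{i+1}^-1 x_i x_{i+1}: these are t by x_i, and -t^-1 t^2 + 1 = 1
  - t by x_{i+1}.\<close>

lemma burau_gen_eq:
  assumes "s \<in> welded_gens n"
  shows "burau_gen n s = fox_mat n (artin_gen n s)"
proof -
  obtain i where s: "s = WSigma i \<or> s = WTau i" and "1 \<le> i" "i < n"
    using assms by (auto simp: welded_gens_def)
  \<comment> \<open>Rows are counted from 0 and generators from 1: the 2 by 2 block of generator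
    \<open>i\<close> starts at row \<open>m\<close>, with \<open>p\<close> rows below it.\<close>
  then obtain m where i: "i = Suc m" "Suc m < n" by (cases i) auto
  then obtain p where n: "n = m + 2 + p" using nat_le_iff_add[of "m + 2" n] by auto
  have sub: "i - 1 = m" "n - i - 1 = p" using i n by auto
  show ?thesis using s
  proof
    assume s: "s = WSigma i"
    have "fox n (Suc a) (artin_gen n s (free_gen n (Suc b))) =
      (if a = m then (if b = m then 0 else if b = Suc m then tvar else 0)
      else if a = Suc m then (if b = m then 1 else if b = Suc m then 1 - tvar else 0)
      else if a = b then 1 else 0)" if "b < n" for a b
    proof -
      consider "b = m" | "b = Suc m" | "b \<noteq> m" "b \<noteq> Suc m" by blast
      then show ?thesis
        using that i unfolding s
        by cases (simp_all add: artin_gen_sigma fox_mult fox_inv fox_gen chi_mult chi_gen chi_inv_gen)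
    qed
    then show ?thesis
      unfolding s burau_gen_def wgen.case sub diag_block_mat_one_2x2_one
      by (intro eq_matI) (simp_all add: fox_mat_def n s)
  next
    assume s: "s = WTau i"
    have "fox n (Suc a) (artin_gen n s (free_gen n (Suc b))) =
      (if a = m then (if b = m then 0 else if b = Suc m then 1 else 0)
      else if a = Suc m then (if b = m then 1 else if b = Suc m then 0 else 0)
      else if a = b then 1 else 0)" if "b < n" for a b
    proof -
      consider "b = m" | "b = Suc m" | "b \<noteq> m" "b \<noteq> Suc m" by blast
      then show ?thesis
        using that i unfolding s by cases (simp_all add: artin_gen_tau fox_gen)
    qed
    then show ?thesis
      unfolding s burau_gen_def wgen.case sub diag_block_mat_one_2x2_one
      by (intro eq_matI) (simp_all add: fox_mat_def n s)
  qed
qed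

text \<open>The Jacobians already form a homomorphism with the Burau values on generators, so no
  matrix relation has to be verified.\<close>

lemma burau_mat_eq:
  assumes "g \<in> carrier (welded_braid n)"
  shows "burau_mat n g = fox_mat n (artin n g)"
  unfolding burau_mat_def
  by (rule W.pres_lift_eq_hom[OF group_gl fox_mat_artin_hom _ assms])
    (simp add: burau_gen_eq artin_gen_value)

lemma burau_mat_hom: "burau_mat n \<in> hom (welded_braid n) (gl n)"
  using fox_mat_artin_hom[of n] by (auto simp: hom_def burau_mat_eq)

lemma burau_mat_carrier: "g \<in> carrier (welded_braid n) \<Longrightarrow> burau_mat n g \<in> carrier_mat n n"
  by (simp add: burau_mat_eq)

lemma fox_vec_artin:
  assumes "g \<in> carrier (welded_braid n)" "x \<in> carrier (free_grp n)"
  shows "fox_vec n (artin n g x) = burau_mat n g *\<^sub>v fox_vec n x"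
  using assms by (simp add: burau_mat_eq fox_vec_chain artin_group_hom chi_artin)

section \<open>The shift homomorphism and the characters of the welded braid groups\<close>

definition shift_gen :: "wgen \<Rightarrow> wgen" where
  "shift_gen s = (case s of WSigma i \<Rightarrow> WSigma (i+1) | WTau i \<Rightarrow> WTau (i+1))"

lemma word_eval_map: "word_eval H f (map (map_prod \<phi> id) w) = word_eval H (f \<circ> \<phi>) w"
  by (induction w) auto

lemma shift_eq: "shift n = pres_lift (welded_braid (n+1))
    (pres_gen (welded_gens (n+1)) (welded_rels (n+1)) \<circ> shift_gen)"
  unfolding shift_def
  by (rule arg_cong[of _ _ "pres_lift _"]) (auto simp: shift_gen_def gen_welded split: wgen.splits)

lemma shift_gen_in: "s \<in> welded_gens n \<Longrightarrow> shift_gen s \<in> welded_gens (n+1)"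
  by (cases s) (auto simp: shift_gen_def)

text \<open>Raising all indices by one preserves their differences and moves the bound from
  \<open>n\<close> to \<open>n+1\<close>, so each family of relations goes into the same
  family.\<close>

lemma shift_relations:
  assumes "(l, r) \<in> welded_rels n"
  shows "(map (map_prod shift_gen id) l, map (map_prod shift_gen id) r) \<in> welded_rels (n+1)"
  using assms[unfolded welded_rels_def]
proof (elim UnE UN_E)
  fix i k assume ik: "i \<in> {1..<n}" "k \<in> {k \<in> {1..<n}. \<bar>int i - int k\<bar> \<ge> 2}"
    and lr: "(l, r) \<in> {(sw i @ sw k, sw k @ sw i), (tw i @ tw k, tw k @ tw i), (sw i @ tw k, tw k @ sw i)}"
  show ?thesis unfolding welded_rels_def
    by (rule UnI1, rule UnI1, rule UnI1, rule UN_I[of "i + 1"], use ik in simp, rule UN_I[of "k + 1"])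
      (use ik lr in \<open>auto simp: shift_gen_def\<close>)
next
  fix i assume i: "i \<in> {i. 1 \<le> i \<and> i + 1 < n}"
    and lr: "(l, r) \<in> {(sw i @ sw (i+1) @ sw i, sw (i+1) @ sw i @ sw (i+1)),
         (tw i @ tw (i+1) @ tw i, tw (i+1) @ tw i @ tw (i+1))}"
  show ?thesis unfolding welded_rels_def
    by (rule UnI1, rule UnI1, rule UnI2, rule UN_I[of "i + 1"]) (use i lr in \<open>auto simp: shift_gen_def\<close>)
next
  fix i assume i: "i \<in> {1..<n}" and lr: "(l, r) \<in> {(tw i @ tw i, [])}"
  show ?thesis unfolding welded_rels_def
    by (rule UnI1, rule UnI2, rule UN_I[of "i + 1"]) (use i lr in \<open>auto simp: shift_gen_def\<close>)
next
  fix i assume i: "i \<in> {i. 1 \<le> i \<and> i + 1 < n}"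
    and lr: "(l, r) \<in> {(tw i @ sw (i+1) @ sw i, sw (i+1) @ sw i @ tw (i+1)),
         (sw i @ tw (i+1) @ tw i, tw (i+1) @ tw i @ sw (i+1))}"
  show ?thesis unfolding welded_rels_def
    by (rule UnI2, rule UN_I[of "i + 1"]) (use i lr in \<open>auto simp: shift_gen_def\<close>)
qed

lemma shift_hom: "shift n \<in> hom (welded_braid n) (welded_braid (n+1))"
  and shift_pres_gen: "s \<in> welded_gens n \<Longrightarrow> shift n (pres_gen (welded_gens n) (welded_rels n) s) =
    pres_gen (welded_gens (n+1)) (welded_rels (n+1)) (shift_gen s)"
proof -
  let ?f = "pres_gen (welded_gens (n+1)) (welded_rels (n+1))"
  have closed: "(?f \<circ> shift_gen) s \<in> carrier (welded_braid (n+1))" if "s \<in> welded_gens n" for s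
    using shift_gen_in[OF that] by auto
  have rel: "word_eval (welded_braid (n+1)) (?f \<circ> shift_gen) l = word_eval (welded_braid (n+1)) (?f \<circ> shift_gen) r"
    if "(l, r) \<in> welded_rels n" for l r
  proof -
    \<comment> \<open>The homomorphism here is the identity: a word evaluated at the generators
      themselves is its own class.\<close>
    have eq: "word_eval (welded_braid (n+1)) ?f w = word_cong (welded_gens (n+1)) (welded_rels (n+1)) `` {w}"
      if "w \<in> lists (welded_gens (n+1) \<times> UNIV)" for w
      by (rule W.word_eval_hom[where h = "\<lambda>x. x", OF W.is_group _ _ that]) (simp_all add: hom_def)
    have cong: "(map (map_prod shift_gen id) l, map (map_prod shift_gen id) r)
        \<in> word_cong (welded_gens (n+1)) (welded_rels (n+1))"
      using word_cong.relator[of "[]" _ "[]", OF _ _ shift_relations[OF that]] by simp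
    then show ?thesis
      unfolding word_eval_map[symmetric]
      using W.word_cong_in_lists[OF cong] by (simp only: eq W.cl_eq_iff)
  qed
  show "shift n \<in> hom (welded_braid n) (welded_braid (n+1))"
    unfolding shift_eq by (rule W.pres_lift_hom[OF W.is_group closed rel])
  show "s \<in> welded_gens n \<Longrightarrow> shift n (pres_gen (welded_gens n) (welded_rels n) s) = ?f (shift_gen s)"
    unfolding shift_eq using W.pres_lift_gen[OF W.is_group closed rel] by simp
qed

lemma unit_char_gen:
  assumes "r \<in> Units laurent_ring" "s \<in> welded_gens n"
  shows "unit_char laurent_ring r (pres_gen (welded_gens n) (welded_rels n) s) =
    (case s of WSigma i \<Rightarrow> r | WTau i \<Rightarrow> 1)"
  using assms by (cases s) (auto simp: gen_welded unit_char_sigma unit_char_tau)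

text \<open>The character depends on the kind of a generator but not on its index, which is all that
  the shift changes.\<close>

lemma unit_char_shift:
  assumes "r \<in> Units laurent_ring" "g \<in> carrier (welded_braid n)"
  shows "unit_char laurent_ring r (shift n g) = unit_char laurent_ring r g"
proof -
  have "(unit_char laurent_ring r \<circ> shift n) g = unit_char laurent_ring r g"
  proof (rule W.hom_unique[OF group_laurent_units hom_compose[OF shift_hom unit_char_hom] unit_char_hom _ assms(2)])
    fix s assume s: "s \<in> welded_gens n"
    show "(unit_char laurent_ring r \<circ> shift n) (pres_gen (welded_gens n) (welded_rels n) s) =
        unit_char laurent_ring r (pres_gen (welded_gens n) (welded_rels n) s)"
      using s shift_gen_in[OF s] assms(1)
      by (simp add: shift_pres_gen unit_char_gen shift_gen_def split: wgen.splits)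
  qed (use assms in auto)
  then show ?thesis by simp
qed

text \<open>A pointwise product of characters is again a character, and this one is trivial on
  generators. It is the cancellation that the twist brings about.\<close>

lemma unit_char_inverse:
  assumes "g \<in> carrier (welded_braid n)"
  shows "unit_char laurent_ring tinv g * unit_char laurent_ring tvar g = 1"
proof -
  interpret h: group_hom "welded_braid n" laurent_units "unit_char laurent_ring tvar"
    by (simp add: group_hom_def group_hom_axioms_def unit_char_hom group_laurent_units W.is_group)
  interpret k: group_hom "welded_braid n" laurent_units "unit_char laurent_ring tinv"
    by (simp add: group_hom_def group_hom_axioms_def unit_char_hom group_laurent_units W.is_group)
  have hom: "(\<lambda>g. unit_char laurent_ring tinv g * unit_char laurent_ring tvar g) \<in> hom (welded_braid n) laurent_units"
    "(\<lambda>g. 1) \<in> hom (welded_braid n) laurent_units"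
  proof (rule homI)
    fix g assume g: "g \<in> carrier (welded_braid n)"
    show "unit_char laurent_ring tinv g * unit_char laurent_ring tvar g \<in> carrier laurent_units"
      using h.H.m_closed[OF k.hom_closed[OF g] h.hom_closed[OF g]] by (simp add: laurent_units_simps)
  next
    fix g g' assume "g \<in> carrier (welded_braid n)" "g' \<in> carrier (welded_braid n)"
    then show "unit_char laurent_ring tinv (g \<otimes>\<^bsub>welded_braid n\<^esub> g') * unit_char laurent_ring tvar (g \<otimes>\<^bsub>welded_braid n\<^esub> g') =
      unit_char laurent_ring tinv g * unit_char laurent_ring tvar g \<otimes>\<^bsub>laurent_units\<^esub>
      (unit_char laurent_ring tinv g' * unit_char laurent_ring tvar g')"
      by (simp add: h.hom_mult k.hom_mult laurent_units_simps mult_ac)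
  qed (use h.H.one_closed in \<open>auto simp: hom_def laurent_units_simps\<close>)
  show ?thesis
    by (rule W.hom_unique[OF group_laurent_units hom _ assms])
      (auto simp: unit_char_gen split: wgen.splits)
qed

lemma tau_desc_closed: "k < m \<Longrightarrow> tau_desc m k \<in> carrier (welded_braid m)"
  by (induction k) (auto simp flip: gen_welded)

text \<open>The image of x_i under \<open>xi\<close> is a conjugate of
  \<open>\<sigma>\<^sub>i \<tau>\<^sub>i\<close>, whose value is t * 1. The conjugating factor drops
  out since the target is commutative.\<close>

lemma unit_char_xi:
  assumes x: "x \<in> carrier (free_grp n)"
  shows "unit_char laurent_ring tvar (xi n x) = chi n x"
proof -
  let ?W = "welded_braid (n+1)"
  let ?f = "\<lambda>i. inv\<^bsub>?W\<^esub> (tau_desc (n+1) (i-1)) \<otimes>\<^bsub>?W\<^esub> (sigma (n+1) i \<otimes>\<^bsub>?W\<^esub> tau (n+1) i)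
    \<otimes>\<^bsub>?W\<^esub> tau_desc (n+1) (i-1)"
  have desc: "tau_desc (n+1) (i-1) \<in> carrier ?W" if "i \<in> {1..n}" for i
    using that by (intro tau_desc_closed) auto
  have st: "sigma (n+1) i \<in> carrier ?W" "tau (n+1) i \<in> carrier ?W" if "i \<in> {1..n}" for i
    using that unfolding gen_welded[symmetric] by auto
  have closed: "?f i \<in> carrier ?W" if "i \<in> {1..n}" for i
    using desc[OF that] st[OF that] by blast
  have hom: "xi n \<in> hom (free_grp n) ?W"
    unfolding xi_def by (rule F.pres_lift_hom[OF W.is_group closed]) auto
  have gen: "xi n (free_gen n i) = ?f i" if "i \<in> {1..n}" for i
    unfolding xi_def by (rule F.pres_lift_gen[OF W.is_group closed]) (use that in auto)
  interpret h: group_hom ?W laurent_units "unit_char laurent_ring tvar"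
    using unit_char_hom[OF tvar_Units]
    by (simp add: group_hom_def group_hom_axioms_def group_laurent_units W.is_group)
  interpret comm_group laurent_units
    by (rule group.group_comm_groupI[OF group_laurent_units]) (simp add: laurent_units_simps mult.commute)
  have "(unit_char laurent_ring tvar \<circ> xi n) x = chi n x"
  proof (rule F.hom_unique[OF group_laurent_units hom_compose[OF hom h.homh] chi_hom _ x])
    fix i assume i: "i \<in> {1..n}"
    let ?a = "unit_char laurent_ring tvar (tau_desc (n+1) (i-1))"
    have "unit_char laurent_ring tvar (?f i) = inv\<^bsub>laurent_units\<^esub> ?a * (tvar * 1) * ?a"
      using desc[OF i] st[OF i] i
      by (simp only: h.hom_mult h.hom_inv W.m_closed W.inv_closed unit_char_sigma unit_char_tau
        tvar_Units laurent_units_simps atLeastAtMost_iff) (simp add: unit_char_sigma unit_char_tau)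
    also have "\<dots> = tvar * (inv\<^bsub>laurent_units\<^esub> ?a \<otimes>\<^bsub>laurent_units\<^esub> ?a)"
      by (simp add: laurent_units_simps mult_ac)
    also have "\<dots> = tvar"
      using h.hom_closed[OF desc[OF i]] by (simp add: laurent_units_simps(2))
    finally show "(unit_char laurent_ring tvar \<circ> xi n) (free_gen n i) = chi n (free_gen n i)"
      using gen[OF i] chi_gen[OF i] by simp
  qed
  then show ?thesis by simp
qed

section \<open>Tensor products with coordinates\<close>

lemmas free_Abelian_group_cases_induct =
  free_Abelian_group_induct[consumes 1, case_names zero diff single]

text \<open>Closure of the four operations places the three kinds of relators inside the free
  abelian group on pairs, which makes \<open>K\<close> a subgroup.\<close>

locale balanced_tensor =
  fixes A :: "('a, 'b) ring_scheme" and M :: "('m, 'c) ring_scheme" and ra :: "'m \<Rightarrow> 'a \<Rightarrow> 'm"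
    and N :: "('n, 'd) ring_scheme" and la :: "'a \<Rightarrow> 'n \<Rightarrow> 'n"
  assumes add_closed_M: "\<And>x y. x \<in> carrier M \<Longrightarrow> y \<in> carrier M \<Longrightarrow> x \<oplus>\<^bsub>M\<^esub> y \<in> carrier M"
    and add_closed_N: "\<And>v w. v \<in> carrier N \<Longrightarrow> w \<in> carrier N \<Longrightarrow> v \<oplus>\<^bsub>N\<^esub> w \<in> carrier N"
    and ra_closed: "\<And>x a. x \<in> carrier M \<Longrightarrow> a \<in> carrier A \<Longrightarrow> ra x a \<in> carrier M"
    and la_closed: "\<And>a v. a \<in> carrier A \<Longrightarrow> v \<in> carrier N \<Longrightarrow> la a v \<in> carrier N"
begin

abbreviation FA where "FA \<equiv> free_Abelian_group (carrier M \<times> carrier N)"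
abbreviation K where "K \<equiv> tensor_rel A M ra N la"
abbreviation T where "T \<equiv> tensor_group A M ra N la"

lemma subgroup_K: "subgroup K FA"
  unfolding tensor_rel_def
proof (rule group.generate_is_subgroup)
  show "{frag_of (x \<oplus>\<^bsub>M\<^esub> y, v) - frag_of (x, v) - frag_of (y, v) | x y v.
        x \<in> carrier M \<and> y \<in> carrier M \<and> v \<in> carrier N}
   \<union> {frag_of (x, v \<oplus>\<^bsub>N\<^esub> w) - frag_of (x, v) - frag_of (x, w) | x v w.
        x \<in> carrier M \<and> v \<in> carrier N \<and> w \<in> carrier N}
   \<union> {frag_of (ra x a, v) - frag_of (x, la a v) | x a v.
        x \<in> carrier M \<and> a \<in> carrier A \<and> v \<in> carrier N} \<subseteq> carrier FA"
    by (auto dest!: subsetD[OF keys_diff] simp: add_closed_M add_closed_N ra_closed la_closed)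
qed simp

lemma K_zero: "0 \<in> K"
  using subgroup.one_closed[OF subgroup_K] by simp

lemma K_add: "c \<in> K \<Longrightarrow> d \<in> K \<Longrightarrow> c + d \<in> K"
  using subgroup.m_closed[OF subgroup_K] by simp

lemma K_keys: "c \<in> K \<Longrightarrow> Poly_Mapping.keys c \<subseteq> carrier M \<times> carrier N"
  using subgroup.mem_carrier[OF subgroup_K] by fastforce

lemma K_minus: "c \<in> K \<Longrightarrow> - c \<in> K"
  using subgroup.m_inv_closed[OF subgroup_K] K_keys by fastforce

lemma K_diff: "c \<in> K \<Longrightarrow> d \<in> K \<Longrightarrow> c - d \<in> K"
  using K_add[OF _ K_minus] by fastforce

lemma K_sum: "(\<And>i. i \<in> I \<Longrightarrow> c i \<in> K) \<Longrightarrow> sum c I \<in> K"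
  by (induction I rule: infinite_finite_induct) (auto simp: K_zero K_add)

lemma K_add_left: "x \<in> carrier M \<Longrightarrow> y \<in> carrier M \<Longrightarrow> v \<in> carrier N \<Longrightarrow>
    frag_of (x \<oplus>\<^bsub>M\<^esub> y, v) - frag_of (x, v) - frag_of (y, v) \<in> K"
  unfolding tensor_rel_def by (intro generate.incl) blast

lemma K_add_right: "x \<in> carrier M \<Longrightarrow> v \<in> carrier N \<Longrightarrow> w \<in> carrier N \<Longrightarrow>
    frag_of (x, v \<oplus>\<^bsub>N\<^esub> w) - frag_of (x, v) - frag_of (x, w) \<in> K"
  unfolding tensor_rel_def by (intro generate.incl) blast

lemma K_balanced: "x \<in> carrier M \<Longrightarrow> a \<in> carrier A \<Longrightarrow> v \<in> carrier N \<Longrightarrow>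
    frag_of (ra x a, v) - frag_of (x, la a v) \<in> K"
  unfolding tensor_rel_def by (intro generate.incl) blast

lemma normal_K: "K \<lhd> FA"
  by (rule comm_group.subgroup_imp_normal[OF abelian_free_Abelian_group subgroup_K])

lemma mem_coset: "d \<in> K #>\<^bsub>FA\<^esub> c \<longleftrightarrow> d - c \<in> K"
  by (auto simp: r_coset_def intro!: bexI[of _ "d - c"])

lemma carrier_T: "carrier T = {K #>\<^bsub>FA\<^esub> c | c. Poly_Mapping.keys c \<subseteq> carrier M \<times> carrier N}"
  by (auto simp: tensor_group_def FactGroup_def RCOSETS_def)

lemma mult_T:
  assumes "Poly_Mapping.keys c \<subseteq> carrier M \<times> carrier N" "Poly_Mapping.keys d \<subseteq> carrier M \<times> carrier N"
  shows "(K #>\<^bsub>FA\<^esub> c) \<otimes>\<^bsub>T\<^esub> (K #>\<^bsub>FA\<^esub> d) = K #>\<^bsub>FA\<^esub> (c + d)"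
  using normal.rcos_sum[OF normal_K, of c d] assms by (simp add: tensor_group_def FactGroup_def)

lemma one_T: "\<one>\<^bsub>T\<^esub> = K #>\<^bsub>FA\<^esub> 0"
  by (auto simp: tensor_group_def FactGroup_def mem_coset)

end

text \<open>The last assumption makes \<open>K\<close> the full kernel of the coordinates: modulo \<open>K\<close>, every element
  has a normal form that is determined by its coordinates.\<close>

locale tensor_coords = balanced_tensor A M ra N la
  for A :: "('a, 'b) ring_scheme" and M :: "('m, 'c) ring_scheme" and ra :: "'m \<Rightarrow> 'a \<Rightarrow> 'm"
    and N :: "('n, 'd) ring_scheme" and la :: "'a \<Rightarrow> 'n \<Rightarrow> 'n" +
  fixes n :: nat and \<beta> :: "nat \<Rightarrow> 'm \<times> 'n \<Rightarrow> laurent"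
  assumes \<beta>_add_left: "\<And>j x y v. j < n \<Longrightarrow> x \<in> carrier M \<Longrightarrow> y \<in> carrier M \<Longrightarrow> v \<in> carrier N \<Longrightarrow>
      \<beta> j (x \<oplus>\<^bsub>M\<^esub> y, v) = \<beta> j (x, v) + \<beta> j (y, v)"
    and \<beta>_add_right: "\<And>j x v w. j < n \<Longrightarrow> x \<in> carrier M \<Longrightarrow> v \<in> carrier N \<Longrightarrow> w \<in> carrier N \<Longrightarrow>
      \<beta> j (x, v \<oplus>\<^bsub>N\<^esub> w) = \<beta> j (x, v) + \<beta> j (x, w)"
    and \<beta>_balanced: "\<And>j x a v. j < n \<Longrightarrow> x \<in> carrier M \<Longrightarrow> a \<in> carrier A \<Longrightarrow> v \<in> carrier N \<Longrightarrow>
      \<beta> j (ra x a, v) = \<beta> j (x, la a v)"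
    and \<beta>_surj: "\<And>w. w \<in> carrier_vec n \<Longrightarrow> \<exists>c. Poly_Mapping.keys c \<subseteq> carrier M \<times> carrier N \<and>
      vec n (\<lambda>j. frag_extend (\<beta> j) c) = w"
    and \<beta>_normal_form: "\<And>c. Poly_Mapping.keys c \<subseteq> carrier M \<times> carrier N \<Longrightarrow>
      \<exists>d. c - d \<in> K \<and> ((\<forall>j<n. frag_extend (\<beta> j) d = 0) \<longrightarrow> d \<in> K)"
begin

definition coords :: "('m \<times> 'n \<Rightarrow>\<^sub>0 int) \<Rightarrow> laurent vec" where
  "coords c = vec n (\<lambda>j. frag_extend (\<beta> j) c)"

definition tensor_iso :: "('m \<times> 'n \<Rightarrow>\<^sub>0 int) set \<Rightarrow> laurent vec" where
  "tensor_iso X = the_elem (coords ` X)"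

lemma coords_carrier [simp]: "coords c \<in> carrier_vec n"
  by (simp add: coords_def)

lemma coords_add: "coords (c + d) = coords c + coords d"
  by (auto simp: coords_def frag_extend_add)

lemma coords_diff: "coords (c - d) = coords c - coords d"
  by (auto simp: coords_def frag_extend_diff)

lemma coords_zero: "coords 0 = 0\<^sub>v n"
  by (auto simp: coords_def)

lemma \<beta>_K:
  assumes "c \<in> K" and j: "j < n"
  shows "frag_extend (\<beta> j) c = 0"
  using assms(1) unfolding tensor_rel_def
proof (induction c rule: generate.induct)
    case (incl h)
    then show ?case
      using j by (auto simp: frag_extend_diff \<beta>_add_left \<beta>_add_right \<beta>_balanced)
  next
    case (inv h)
    then have "h \<in> K" unfolding tensor_rel_def by (rule generate.incl)
    then have "inv\<^bsub>FA\<^esub> h = - h" using K_keys by simp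
    then show ?case
      using j inv by (auto simp: frag_extend_minus frag_extend_diff \<beta>_add_left \<beta>_add_right \<beta>_balanced)
  qed (simp_all add: frag_extend_add)

lemma coords_K: "c \<in> K \<Longrightarrow> coords c = 0\<^sub>v n"
  by (auto simp: coords_def \<beta>_K)

text \<open>Passing to the normal form \<open>d\<close> does not change coordinates, and a normal
  form with zero coordinates lies in \<open>K\<close>.\<close>

lemma \<beta>_inj:
  assumes c: "Poly_Mapping.keys c \<subseteq> carrier M \<times> carrier N"
    and zero: "\<And>j. j < n \<Longrightarrow> frag_extend (\<beta> j) c = 0"
  shows "c \<in> K"
proof -
  obtain d where d: "c - d \<in> K" "(\<forall>j<n. frag_extend (\<beta> j) d = 0) \<longrightarrow> d \<in> K"
    using \<beta>_normal_form[OF c] by blast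
  have "frag_extend (\<beta> j) d = 0" if "j < n" for j
    using \<beta>_K[OF d(1) that] zero[OF that] by (simp add: frag_extend_diff)
  then show ?thesis using K_add[OF d(1), of d] d(2) by simp
qed

lemma coords_eq_iff:
  assumes "Poly_Mapping.keys c \<subseteq> carrier M \<times> carrier N" "Poly_Mapping.keys d \<subseteq> carrier M \<times> carrier N"
  shows "coords c = coords d \<longleftrightarrow> c - d \<in> K"
proof
  assume "c - d \<in> K"
  from coords_K[OF this] have "coords c - coords d = 0\<^sub>v n" by (simp add: coords_diff)
  then show "coords c = coords d"
    by (auto simp: coords_def vec_eq_iff)
next
  assume eq: "coords c = coords d"
  show "c - d \<in> K"
  proof (rule \<beta>_inj)
    show "Poly_Mapping.keys (c - d) \<subseteq> carrier M \<times> carrier N"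
      using keys_diff[of c d] assms by blast
    show "frag_extend (\<beta> j) (c - d) = 0" if "j < n" for j
      using arg_cong[OF eq, of "\<lambda>v. v $ j"] that by (simp add: coords_def frag_extend_diff)
  qed
qed

lemma coset_eq_iff:
  assumes "Poly_Mapping.keys c \<subseteq> carrier M \<times> carrier N" "Poly_Mapping.keys d \<subseteq> carrier M \<times> carrier N"
  shows "K #>\<^bsub>FA\<^esub> c = K #>\<^bsub>FA\<^esub> d \<longleftrightarrow> c - d \<in> K"
proof
  assume "K #>\<^bsub>FA\<^esub> c = K #>\<^bsub>FA\<^esub> d"
  moreover have "c \<in> K #>\<^bsub>FA\<^esub> c" by (simp add: mem_coset K_zero)
  ultimately show "c - d \<in> K" by (simp add: mem_coset)
next
  assume cd: "c - d \<in> K"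
  have "e - c \<in> K \<longleftrightarrow> e - d \<in> K" for e
    using K_add[OF _ cd, of "e - c"] K_diff[OF _ cd, of "e - d"] by auto
  then show "K #>\<^bsub>FA\<^esub> c = K #>\<^bsub>FA\<^esub> d" by (auto simp: mem_coset)
qed

lemma the_elem_image_coset:
  assumes "\<And>d. d - c \<in> K \<Longrightarrow> f d = f c"
  shows "the_elem (f ` (K #>\<^bsub>FA\<^esub> c)) = f c"
proof -
  have "c \<in> K #>\<^bsub>FA\<^esub> c" by (simp add: mem_coset K_zero)
  moreover have "f d = f c" if "d \<in> K #>\<^bsub>FA\<^esub> c" for d
    using that assms by (simp only: mem_coset)
  ultimately have "f ` (K #>\<^bsub>FA\<^esub> c) = {f c}" by blast
  then show ?thesis by simp
qed

lemma coset_keys: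
  assumes "d - c \<in> K" "Poly_Mapping.keys c \<subseteq> carrier M \<times> carrier N"
  shows "Poly_Mapping.keys d \<subseteq> carrier M \<times> carrier N"
  using keys_add[of "d - c" c] K_keys[OF assms(1)] assms(2) by auto

lemma tensor_iso_coset:
  assumes "Poly_Mapping.keys c \<subseteq> carrier M \<times> carrier N"
  shows "tensor_iso (K #>\<^bsub>FA\<^esub> c) = coords c"
  unfolding tensor_iso_def
proof (rule the_elem_image_coset)
  fix d assume d: "d - c \<in> K"
  then show "coords d = coords c"
    using coords_eq_iff[OF coset_keys[OF d assms] assms] by (rule iffD2[rotated])
qed

lemma bij_tensor_iso: "bij_betw tensor_iso (carrier T) (carrier_vec n)"
proof (rule bij_betwI')
  show "(tensor_iso X = tensor_iso Y) = (X = Y)" if "X \<in> carrier T" "Y \<in> carrier T" for X Y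
    using that unfolding carrier_T by clarify (simp only: tensor_iso_coset coords_eq_iff coset_eq_iff)
  show "tensor_iso X \<in> carrier_vec n" if "X \<in> carrier T" for X
    using that by (auto simp: carrier_T tensor_iso_coset)
  show "\<exists>X\<in>carrier T. w = tensor_iso X" if w: "w \<in> carrier_vec n" for w
  proof -
    obtain c where "Poly_Mapping.keys c \<subseteq> carrier M \<times> carrier N" "coords c = w"
      using \<beta>_surj[OF w] by (auto simp: coords_def)
    then show ?thesis by (intro bexI[of _ "K #>\<^bsub>FA\<^esub> c"]) (auto simp: carrier_T tensor_iso_coset)
  qed
qed

lemma tensor_iso_mult:
  assumes "X \<in> carrier T" "Y \<in> carrier T"
  shows "X \<otimes>\<^bsub>T\<^esub> Y \<in> carrier T \<and> tensor_iso (X \<otimes>\<^bsub>T\<^esub> Y) = tensor_iso X + tensor_iso Y"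
proof -
  obtain c d where c: "Poly_Mapping.keys c \<subseteq> carrier M \<times> carrier N" "X = K #>\<^bsub>FA\<^esub> c"
    and d: "Poly_Mapping.keys d \<subseteq> carrier M \<times> carrier N" "Y = K #>\<^bsub>FA\<^esub> d"
    using assms by (auto simp: carrier_T)
  have "Poly_Mapping.keys (c + d) \<subseteq> carrier M \<times> carrier N"
    using keys_add[of c d] c d by blast
  then show ?thesis using c d by (auto simp: carrier_T mult_T tensor_iso_coset coords_add)
qed

lemma tensor_iso_one: "\<one>\<^bsub>T\<^esub> \<in> carrier T \<and> tensor_iso \<one>\<^bsub>T\<^esub> = 0\<^sub>v n"
  by (auto simp: carrier_T one_T tensor_iso_coset coords_zero intro!: exI[of _ 0])

text \<open>That f \<otimes> g is well defined is not tested on relators. In coordinates the map is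
  multiplication by \<open>L\<close>, so representatives of one coset have images with equal
  coordinates, and these lie in one coset by injectivity.\<close>

lemma tensor_iso_map:
  assumes f: "\<And>x. x \<in> carrier M \<Longrightarrow> f x \<in> carrier M" and g: "\<And>v. v \<in> carrier N \<Longrightarrow> g v \<in> carrier N"
    and L: "L \<in> carrier_mat n n"
    and eq: "\<And>x v. x \<in> carrier M \<Longrightarrow> v \<in> carrier N \<Longrightarrow>
      vec n (\<lambda>j. \<beta> j (f x, g v)) = L *\<^sub>v vec n (\<lambda>j. \<beta> j (x, v))"
    and X: "X \<in> carrier T"
  shows "tensor_map A M ra N la f g X \<in> carrier T \<and>
    tensor_iso (tensor_map A M ra N la f g X) = L *\<^sub>v tensor_iso X"
proof -
  let ?F = "frag_extend (\<lambda>(x, v). frag_of (f x, g v))"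
  have F_keys: "Poly_Mapping.keys (?F c) \<subseteq> carrier M \<times> carrier N"
    if "Poly_Mapping.keys c \<subseteq> carrier M \<times> carrier N" for c
    using that f g by (intro order.trans[OF keys_frag_extend]) auto
  have F_coords: "coords (?F c) = L *\<^sub>v coords c"
    if "Poly_Mapping.keys c \<subseteq> carrier M \<times> carrier N" for c
    using that
  proof (induction c rule: free_Abelian_group_cases_induct)
    case zero
    then show ?case using L by (auto simp: coords_zero intro!: eq_vecI)
  next
    case (diff x y)
    then show ?case using L
      by (simp add: frag_extend_diff coords_diff mult_minus_distrib_mat_vec[OF L])
  next
    case (single a)
    then show ?case using eq by (auto simp: coords_def)
  qed
  obtain c where c: "Poly_Mapping.keys c \<subseteq> carrier M \<times> carrier N" "X = K #>\<^bsub>FA\<^esub> c"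
    using X by (auto simp: carrier_T)
  have "tensor_map A M ra N la f g X = the_elem ((\<lambda>c. K #>\<^bsub>FA\<^esub> ?F c) ` X)"
    using X by (simp add: tensor_map_def)
  also have "\<dots> = K #>\<^bsub>FA\<^esub> ?F c"
    unfolding c(2)
  proof (rule the_elem_image_coset)
    fix d assume d: "d - c \<in> K"
    have kd: "Poly_Mapping.keys d \<subseteq> carrier M \<times> carrier N" by (rule coset_keys[OF d c(1)])
    have "coords d = coords c" using d kd c(1) coords_eq_iff by blast
    then have "coords (?F d) = coords (?F c)" by (simp add: F_coords kd c(1))
    then show "K #>\<^bsub>FA\<^esub> ?F d = K #>\<^bsub>FA\<^esub> ?F c"
      using F_keys[OF kd] F_keys[OF c(1)] by (simp add: coset_eq_iff coords_eq_iff)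
  qed
  finally have "tensor_map A M ra N la f g X = K #>\<^bsub>FA\<^esub> ?F c" .
  then show ?thesis
    using F_keys[OF c(1)] c F_coords[OF c(1)] by (auto simp: carrier_T tensor_iso_coset)
qed

end

text \<open>An isomorphism with the free module of rank \<open>n\<close>, stated with closure
  conditions because \<open>V\<close> is a bare record whose module axioms are to be deduced from
  it.\<close>

definition vec_iso :: "nat \<Rightarrow> (laurent, 'v) module \<Rightarrow> ('v \<Rightarrow> laurent vec) \<Rightarrow> bool" where
  "vec_iso n V \<phi> \<longleftrightarrow> bij_betw \<phi> (carrier V) (carrier_vec n) \<and>
    (\<forall>x\<in>carrier V. \<forall>y\<in>carrier V. x \<oplus>\<^bsub>V\<^esub> y \<in> carrier V \<and> \<phi> (x \<oplus>\<^bsub>V\<^esub> y) = \<phi> x + \<phi> y) \<and>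
    \<zero>\<^bsub>V\<^esub> \<in> carrier V \<and> \<phi> \<zero>\<^bsub>V\<^esub> = 0\<^sub>v n \<and>
    (\<forall>r. \<forall>x\<in>carrier V. r \<odot>\<^bsub>V\<^esub> x \<in> carrier V \<and> \<phi> (r \<odot>\<^bsub>V\<^esub> x) = r \<cdot>\<^sub>v \<phi> x)"

lemma smult_mat_mult_vec:
  fixes A :: "'a :: comm_semiring_0 mat"
  assumes "A \<in> carrier_mat m n" "v \<in> carrier_vec n"
  shows "(r \<cdot>\<^sub>m A) *\<^sub>v v = r \<cdot>\<^sub>v (A *\<^sub>v v)"
  using assms by (intro eq_vecI) (auto simp: scalar_prod_def sum_distrib_left mult.assoc)

lemma vec_iso_tensor_module:
  fixes N :: "(laurent, 'n, 'd) module_scheme"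
  assumes "tensor_coords A M ra N la n \<beta>"
    and smult: "\<And>r v. v \<in> carrier N \<Longrightarrow> r \<odot>\<^bsub>N\<^esub> v \<in> carrier N"
    and \<beta>: "\<And>r j x v. j < n \<Longrightarrow> x \<in> carrier M \<Longrightarrow> v \<in> carrier N \<Longrightarrow> \<beta> j (x, r \<odot>\<^bsub>N\<^esub> v) = r * \<beta> j (x, v)"
  shows "vec_iso n (tensor_module A M ra N la) (tensor_coords.tensor_iso n \<beta>)"
proof -
  interpret tensor_coords A M ra N la n \<beta> by fact
  \<comment> \<open>Scalars on the tensor product are themselves a \<open>tensor_map\<close>; in
    coordinates its matrix is the scalar matrix.\<close>
  have one: "(r \<cdot>\<^sub>m 1\<^sub>m n) *\<^sub>v v = r \<cdot>\<^sub>v v" if "v \<in> carrier_vec n" for r :: laurent and v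
    using that by (simp add: smult_mat_mult_vec[of _ n n])
  have "tensor_map A M ra N la (\<lambda>x. x) (\<lambda>v. r \<odot>\<^bsub>N\<^esub> v) X \<in> carrier T \<and>
      tensor_iso (tensor_map A M ra N la (\<lambda>x. x) (\<lambda>v. r \<odot>\<^bsub>N\<^esub> v) X) = (r \<cdot>\<^sub>m 1\<^sub>m n) *\<^sub>v tensor_iso X"
    if "X \<in> carrier T" for r X
    by (rule tensor_iso_map[OF _ _ _ _ that]) (auto simp: smult \<beta> one)
  moreover note one
  ultimately show ?thesis
    using bij_tensor_iso tensor_iso_mult tensor_iso_one bij_betwE[OF bij_tensor_iso] by (auto simp: vec_iso_def tensor_module_def)
qed

section \<open>Representations transported along an isomorphism\<close>

lemma cring_laurent: "cring laurent_ring"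
  by unfold_locales (auto simp: algebra_simps Units_def intro: exI[of _ "- _"])

text \<open>Every axiom is an identity that \<open>\<phi>\<close> carries to a known identity of
  vectors and that injectivity carries back.\<close>

lemma module_vec_iso:
  assumes "vec_iso n V \<phi>"
  shows "Module.module laurent_ring V"
proof -
  have bij: "bij_betw \<phi> (carrier V) (carrier_vec n)"
    and add: "\<And>x y. x \<in> carrier V \<Longrightarrow> y \<in> carrier V \<Longrightarrow> x \<oplus>\<^bsub>V\<^esub> y \<in> carrier V"
      "\<And>x y. x \<in> carrier V \<Longrightarrow> y \<in> carrier V \<Longrightarrow> \<phi> (x \<oplus>\<^bsub>V\<^esub> y) = \<phi> x + \<phi> y"
    and zero: "\<zero>\<^bsub>V\<^esub> \<in> carrier V" "\<phi> \<zero>\<^bsub>V\<^esub> = 0\<^sub>v n"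
    and smult: "\<And>r x. x \<in> carrier V \<Longrightarrow> r \<odot>\<^bsub>V\<^esub> x \<in> carrier V"
      "\<And>r x. x \<in> carrier V \<Longrightarrow> \<phi> (r \<odot>\<^bsub>V\<^esub> x) = r \<cdot>\<^sub>v \<phi> x"
    using assms by (auto simp: vec_iso_def)
  have carr: "\<phi> x \<in> carrier_vec n" if "x \<in> carrier V" for x
    using bij that by (auto dest: bij_betwE)
  have eqI: "x = y" if "x \<in> carrier V" "y \<in> carrier V" "\<phi> x = \<phi> y" for x y
    using bij that by (auto simp: bij_betw_def inj_on_def)
  have "abelian_group V"
  proof (rule abelian_groupI)
    fix x y z assume "x \<in> carrier V" "y \<in> carrier V" "z \<in> carrier V"
    then show "x \<oplus>\<^bsub>V\<^esub> y \<oplus>\<^bsub>V\<^esub> z = x \<oplus>\<^bsub>V\<^esub> (y \<oplus>\<^bsub>V\<^esub> z)"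
      using carr by (intro eqI) (auto simp: add assoc_add_vec[of _ n])
  next
    fix x y assume "x \<in> carrier V" "y \<in> carrier V"
    then show "x \<oplus>\<^bsub>V\<^esub> y = y \<oplus>\<^bsub>V\<^esub> x"
      using carr by (intro eqI) (auto simp: add comm_add_vec[of _ n])
  next
    fix x assume x: "x \<in> carrier V"
    then show "\<zero>\<^bsub>V\<^esub> \<oplus>\<^bsub>V\<^esub> x = x"
      using carr by (intro eqI) (auto simp: add zero)
    \<comment> \<open>Negatives come from surjectivity: a preimage of \<open>- \<phi> x\<close> is
      the opposite of \<open>x\<close>.\<close>
    have "- \<phi> x \<in> \<phi> ` carrier V"
      using carr[OF x] bij by (simp add: bij_betw_def)
    then obtain y where y: "y \<in> carrier V" "\<phi> y = - \<phi> x" by auto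
    have "y \<oplus>\<^bsub>V\<^esub> x = \<zero>\<^bsub>V\<^esub>"
      using x y carr[OF x] by (intro eqI) (auto simp: add zero)
    then show "\<exists>y\<in>carrier V. y \<oplus>\<^bsub>V\<^esub> x = \<zero>\<^bsub>V\<^esub>" using y by blast
  qed (auto simp: add zero)
  then show ?thesis
  proof (rule moduleI[OF cring_laurent])
    fix a b :: laurent and x y assume xy: "x \<in> carrier V" "y \<in> carrier V"
    show "(a \<oplus>\<^bsub>laurent_ring\<^esub> b) \<odot>\<^bsub>V\<^esub> x = a \<odot>\<^bsub>V\<^esub> x \<oplus>\<^bsub>V\<^esub> b \<odot>\<^bsub>V\<^esub> x"
      using xy carr by (intro eqI) (auto simp: add smult add_smult_distrib_vec)
    show "a \<odot>\<^bsub>V\<^esub> (x \<oplus>\<^bsub>V\<^esub> y) = a \<odot>\<^bsub>V\<^esub> x \<oplus>\<^bsub>V\<^esub> a \<odot>\<^bsub>V\<^esub> y"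
      using xy carr by (intro eqI) (auto simp: add smult smult_add_distrib_vec[of _ n])
    show "(a \<otimes>\<^bsub>laurent_ring\<^esub> b) \<odot>\<^bsub>V\<^esub> x = a \<odot>\<^bsub>V\<^esub> (b \<odot>\<^bsub>V\<^esub> x)"
      using xy carr by (intro eqI) (auto simp: smult smult_smult_assoc)
    show "\<one>\<^bsub>laurent_ring\<^esub> \<odot>\<^bsub>V\<^esub> x = x"
      using xy carr by (intro eqI) (auto simp: smult)
  qed (auto simp: smult)
qed

lemma mult_mat_smult_vec:
  fixes A :: "'a :: comm_semiring_0 mat"
  assumes "A \<in> carrier_mat m n" "v \<in> carrier_vec n"
  shows "A *\<^sub>v (r \<cdot>\<^sub>v v) = r \<cdot>\<^sub>v (A *\<^sub>v v)"
  using assms by (intro eq_vecI) (auto simp: scalar_prod_def sum_distrib_left mult.left_commute)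

text \<open>The action is the conjugate by \<open>\<phi>\<close> of matrix multiplication, hence
  linear, multiplicative and invertible. Extensionality makes equality of maps on the carrier an
  equality of elements of \<open>Bij\<close>.\<close>

lemma is_repr_vec_iso:
  assumes G: "group G" and B: "B \<in> hom G (gl n)" and V: "vec_iso n V \<phi>"
    and ext: "\<And>g. g \<in> carrier G \<Longrightarrow> \<rho> g \<in> extensional (carrier V)"
    and closed: "\<And>g x. g \<in> carrier G \<Longrightarrow> x \<in> carrier V \<Longrightarrow> \<rho> g x \<in> carrier V"
    and \<rho>: "\<And>g x. g \<in> carrier G \<Longrightarrow> x \<in> carrier V \<Longrightarrow> \<phi> (\<rho> g x) = B g *\<^sub>v \<phi> x"
  shows "is_repr G laurent_ring (V, \<rho>)"
proof -
  interpret group G by fact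
  have bij: "bij_betw \<phi> (carrier V) (carrier_vec n)"
    and add: "\<And>x y. x \<in> carrier V \<Longrightarrow> y \<in> carrier V \<Longrightarrow> x \<oplus>\<^bsub>V\<^esub> y \<in> carrier V"
      "\<And>x y. x \<in> carrier V \<Longrightarrow> y \<in> carrier V \<Longrightarrow> \<phi> (x \<oplus>\<^bsub>V\<^esub> y) = \<phi> x + \<phi> y"
    and smult: "\<And>r x. x \<in> carrier V \<Longrightarrow> r \<odot>\<^bsub>V\<^esub> x \<in> carrier V"
      "\<And>r x. x \<in> carrier V \<Longrightarrow> \<phi> (r \<odot>\<^bsub>V\<^esub> x) = r \<cdot>\<^sub>v \<phi> x"
    using V by (auto simp: vec_iso_def)
  have carr: "\<phi> x \<in> carrier_vec n" if "x \<in> carrier V" for x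
    using bij that by (auto dest: bij_betwE)
  have eqI: "x = y" if "x \<in> carrier V" "y \<in> carrier V" "\<phi> x = \<phi> y" for x y
    using bij that by (auto simp: bij_betw_def inj_on_def)
  have B_carr: "B g \<in> carrier_mat n n" if "g \<in> carrier G" for g
    using hom_in_carrier[OF B that] by (auto simp: units_of_carrier Units_def ring_mat_simps)
  have B_mult: "B (g \<otimes>\<^bsub>G\<^esub> h) = B g * B h" if "g \<in> carrier G" "h \<in> carrier G" for g h
    using hom_mult[OF B that] by (simp add: units_of_mult ring_mat_simps)
  have B_one: "B \<one>\<^bsub>G\<^esub> = 1\<^sub>m n"
    using hom_one[OF B G group_gl] by (simp add: units_of_one ring_mat_simps)
  have \<rho>_mult: "\<rho> (g \<otimes>\<^bsub>G\<^esub> h) x = \<rho> g (\<rho> h x)"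
    if "g \<in> carrier G" "h \<in> carrier G" "x \<in> carrier V" for g h x
  proof (rule eqI)
    show "\<phi> (\<rho> (g \<otimes>\<^bsub>G\<^esub> h) x) = \<phi> (\<rho> g (\<rho> h x))"
      using that by (simp add: closed \<rho> B_mult assoc_mult_mat_vec[OF B_carr B_carr carr])
  qed (use that closed in auto)
  have \<rho>_one: "\<rho> \<one>\<^bsub>G\<^esub> x = x" if "x \<in> carrier V" for x
    using that carr by (intro eqI) (auto simp: closed \<rho> B_one)
  have auts: "\<rho> g \<in> LinearCombinations.module_hom laurent_ring V V \<inter> Bij (carrier V)"
    if g: "g \<in> carrier G" for g
  proof
    have "\<rho> g (x \<oplus>\<^bsub>V\<^esub> y) = \<rho> g x \<oplus>\<^bsub>V\<^esub> \<rho> g y" if "x \<in> carrier V" "y \<in> carrier V" for x y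
      using that g
      by (intro eqI) (auto simp: add closed \<rho> mult_add_distrib_mat_vec[OF B_carr carr carr])
    moreover have "\<rho> g (r \<odot>\<^bsub>V\<^esub> x) = r \<odot>\<^bsub>V\<^esub> \<rho> g x" if "x \<in> carrier V" for r x
      using that g
      by (intro eqI) (auto simp: smult closed \<rho> mult_mat_smult_vec[OF B_carr carr])
    ultimately show "\<rho> g \<in> LinearCombinations.module_hom laurent_ring V V"
      using g closed by (auto simp: LinearCombinations.module_hom_def)
    have "bij_betw (\<rho> g) (carrier V) (carrier V)"
      by (rule bij_betw_byWitness[where f' = "\<rho> (inv\<^bsub>G\<^esub> g)"])
        (use g closed in \<open>auto simp: \<rho>_one simp flip: \<rho>_mult\<close>)
    then show "\<rho> g \<in> Bij (carrier V)" using ext[OF g] by (simp add: Bij_def)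
  qed
  have "\<rho> \<in> hom G (linear_auts laurent_ring V)"
  proof (rule homI)
    show "\<rho> g \<in> carrier (linear_auts laurent_ring V)" if "g \<in> carrier G" for g
      using auts[OF that] by (simp add: linear_auts_def)
    show "\<rho> (g \<otimes>\<^bsub>G\<^esub> h) = \<rho> g \<otimes>\<^bsub>linear_auts laurent_ring V\<^esub> \<rho> h"
      if "g \<in> carrier G" "h \<in> carrier G" for g h
    proof (rule extensionalityI[of _ "carrier V"])
      show "\<rho> (g \<otimes>\<^bsub>G\<^esub> h) \<in> extensional (carrier V)" using that ext by simp
      show "\<rho> g \<otimes>\<^bsub>linear_auts laurent_ring V\<^esub> \<rho> h \<in> extensional (carrier V)"
        using that auts by (simp add: linear_auts_def BijGroup_def)
      show "\<rho> (g \<otimes>\<^bsub>G\<^esub> h) x = (\<rho> g \<otimes>\<^bsub>linear_auts laurent_ring V\<^esub> \<rho> h) x" if "x \<in> carrier V" for x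
        using that \<open>g \<in> carrier G\<close> \<open>h \<in> carrier G\<close> auts \<rho>_mult
        by (simp add: linear_auts_def BijGroup_def compose_def)
    qed
  qed
  then show ?thesis using G module_vec_iso[OF V] by (simp add: is_repr_def)
qed

text \<open>The intertwiner is \<open>\<phi>\<close> itself, and the matrix representation is the
  instance in which \<open>\<phi>\<close> is the identity on vectors.\<close>

lemma equivalent_reprs_vec_iso:
  assumes G: "group G" and B: "B \<in> hom G (gl n)" and V: "vec_iso n V \<phi>"
    and ext: "\<And>g. g \<in> carrier G \<Longrightarrow> \<rho> g \<in> extensional (carrier V)"
    and closed: "\<And>g x. g \<in> carrier G \<Longrightarrow> x \<in> carrier V \<Longrightarrow> \<rho> g x \<in> carrier V"
    and \<rho>: "\<And>g x. g \<in> carrier G \<Longrightarrow> x \<in> carrier V \<Longrightarrow> \<phi> (\<rho> g x) = B g *\<^sub>v \<phi> x"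
  shows "equivalent_reprs G laurent_ring (V, \<rho>)
    (module_vec TYPE(laurent) n, \<lambda>g. \<lambda>v\<in>carrier_vec n. B g *\<^sub>v v)"
proof -
  have B_carr: "B g \<in> carrier_mat n n" if "g \<in> carrier G" for g
    using hom_in_carrier[OF B that] by (auto simp: units_of_carrier Units_def ring_mat_simps)
  have "vec_iso n (module_vec TYPE(laurent) n) (\<lambda>v. v)"
    by (auto simp: vec_iso_def module_vec_simps bij_betw_def)
  then have "is_repr G laurent_ring (module_vec TYPE(laurent) n, \<lambda>g. \<lambda>v\<in>carrier_vec n. B g *\<^sub>v v)"
    by (rule is_repr_vec_iso[OF G B]) (auto simp: module_vec_simps dest!: B_carr)
  moreover have "is_repr G laurent_ring (V, \<rho>)"
    by (rule is_repr_vec_iso[OF assms])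
  moreover have "\<phi> \<in> LinearCombinations.module_hom laurent_ring V (module_vec TYPE(laurent) n)"
    using V by (auto simp: vec_iso_def LinearCombinations.module_hom_def module_vec_simps dest: bij_betwE)
  moreover have "\<phi> x \<in> carrier_vec n" if "x \<in> carrier V" for x
    using V that by (auto simp: vec_iso_def dest: bij_betwE)
  ultimately show ?thesis
    using V \<rho> unfolding equivalent_reprs_def
    by (auto simp: vec_iso_def module_vec_simps intro!: exI[of _ \<phi>])
qed

section \<open>The augmentation ideal of a free group\<close>

lemma group_ring_simps:
  "carrier (group_ring G) = {a. Poly_Mapping.keys a \<subseteq> carrier G}"
  "\<zero>\<^bsub>group_ring G\<^esub> = 0"
  "a \<oplus>\<^bsub>group_ring G\<^esub> b = a + b"
  "a \<otimes>\<^bsub>group_ring G\<^esub> b = frag_extend (\<lambda>g. frag_extend (\<lambda>h. frag_of (g \<otimes>\<^bsub>G\<^esub> h)) b) a"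
  by (simp_all add: group_ring_def)

text \<open>Keys can cancel in a sum or difference; summing over a common finite superset makes the
  augmentations comparable.\<close>

lemma augmentation_superset:
  assumes "finite S" "Poly_Mapping.keys a \<subseteq> S"
  shows "augmentation a = (\<Sum>g\<in>S. Poly_Mapping.lookup a g)"
  unfolding augmentation_def
  by (rule sum.mono_neutral_left) (use assms in \<open>auto simp: in_keys_iff\<close>)

lemma augmentation_simps [simp]:
  "augmentation 0 = 0" "augmentation (frag_of g) = 1"
  "augmentation (a - b) = augmentation a - augmentation b"
  "augmentation (a + b) = augmentation a + augmentation b"
proof -
  let ?S = "Poly_Mapping.keys a \<union> Poly_Mapping.keys b"
  have "augmentation (a - b) = (\<Sum>g\<in>?S. Poly_Mapping.lookup (a - b) g)"
    using keys_diff[of a b] by (intro augmentation_superset) auto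
  then show "augmentation (a - b) = augmentation a - augmentation b"
    by (simp add: augmentation_superset[of ?S a] augmentation_superset[of ?S b] lookup_minus
      sum_subtractf)
  have "augmentation (a + b) = (\<Sum>g\<in>?S. Poly_Mapping.lookup (a + b) g)"
    using keys_add[of a b] by (intro augmentation_superset) auto
  then show "augmentation (a + b) = augmentation a + augmentation b"
    by (simp add: augmentation_superset[of ?S a] augmentation_superset[of ?S b] lookup_add
      sum.distrib)
qed (simp_all add: augmentation_def)

lemma augmentation_cmul: "augmentation (frag_cmul k a) = k * augmentation a"
  using keys_cmul[of k a]
  by (simp add: augmentation_superset[of "Poly_Mapping.keys a"] sum_distrib_left)

lemma augmentation_frag_extend_of:
  "augmentation (frag_extend (\<lambda>x. frag_of (f x)) a) = augmentation a"
proof -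
  have "Poly_Mapping.keys a \<subseteq> UNIV" by simp
  then show ?thesis
    by (induction a rule: free_Abelian_group_cases_induct) (simp_all add: frag_extend_diff)
qed

text \<open>This and the next two definitions name what \<open>long_moody\<close> binds locally, for
  the representation t.\<close>

definition aug_module :: "nat \<Rightarrow> (nat word set \<Rightarrow>\<^sub>0 int) ring" where
  "aug_module n = group_ring (free_grp n)\<lparr>carrier := augmentation_ideal (free_grp n)\<rparr>"

definition aug_act :: "nat \<Rightarrow> (nat word set \<Rightarrow>\<^sub>0 int) \<Rightarrow> (nat word set \<Rightarrow>\<^sub>0 int) \<Rightarrow> (nat word set \<Rightarrow>\<^sub>0 int)" where
  "aug_act n i a = i \<otimes>\<^bsub>group_ring (free_grp n)\<^esub> a"

definition char_act :: "nat \<Rightarrow> (nat word set \<Rightarrow>\<^sub>0 int) \<Rightarrow> laurent \<Rightarrow> laurent" where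
  "char_act n = group_ring_act (regular_module laurent_ring)
    (\<lambda>x. \<lambda>v\<in>carrier laurent_ring. unit_char laurent_ring tvar (xi n x) \<otimes>\<^bsub>laurent_ring\<^esub> v)"

lemma aug_module_simps:
  "i \<in> carrier (aug_module n) \<longleftrightarrow>
    Poly_Mapping.keys i \<subseteq> carrier (free_grp n) \<and> augmentation i = 0"
  "i \<oplus>\<^bsub>aug_module n\<^esub> j = i + j"
  by (auto simp: aug_module_def augmentation_ideal_def group_ring_def)

text \<open>By \<open>unit_char_xi\<close> a group element acts as multiplication by its value under
  \<open>chi\<close>, and the group ring by the linear extension.\<close>

lemma char_act_eq:
  assumes "Poly_Mapping.keys a \<subseteq> carrier (free_grp n)"
  shows "char_act n a v = frag_extend (chi n) a * v"
proof -
  \<comment> \<open>Laurent polynomials are integer combinations of exponents, so their additive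
    group is literally a free abelian group and its integer multiples are
    \<open>frag_cmul\<close>.\<close>
  have pow: "add_pow (regular_module laurent_ring) (k :: int) x = frag_cmul k x" for k x
  proof -
    have "add_pow (regular_module laurent_ring) k x = add_pow laurent_ring k x"
      by (simp add: regular_module_def add_pow_def int_pow_def nat_pow_def m_inv_def Let_def cong: if_cong)
    moreover have "add_monoid laurent_ring = free_Abelian_group UNIV"
      by (simp add: free_Abelian_group_def)
    ultimately show ?thesis by (simp add: add_pow_def)
  qed
  have finsum: "finsum (regular_module laurent_ring) f S = sum f S" for f :: "_ \<Rightarrow> laurent" and S
  proof -
    have "finsum (regular_module laurent_ring) f S = finsum laurent_ring f S"
      by (simp add: finsum_def finprod_def regular_module_def)
    then show ?thesis by (simp add: class_ring_simps)
  qed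
  have "frag_cmul k x * v = frag_cmul k (x * v)" for k and x :: laurent
    by (induction k rule: int_induct[where k = 0])
      (simp_all add: frag_cmul_distrib frag_cmul_diff_distrib algebra_simps)
  then show ?thesis
    using assms
    by (auto simp: char_act_def group_ring_act_def pow finsum frag_extend_def sum_distrib_right unit_char_xi
      intro!: sum.cong)
qed

lemma keys_aug_act:
  assumes "Poly_Mapping.keys i \<subseteq> carrier (free_grp n)" "Poly_Mapping.keys a \<subseteq> carrier (free_grp n)"
  shows "Poly_Mapping.keys (aug_act n i a) \<subseteq> carrier (free_grp n)"
  unfolding aug_act_def group_ring_simps
proof (rule order.trans[OF keys_frag_extend], rule UN_least)
  fix g assume "g \<in> Poly_Mapping.keys i"
  then show "Poly_Mapping.keys (frag_extend (\<lambda>h. frag_of (g \<otimes>\<^bsub>free_grp n\<^esub> h)) a) \<subseteq> carrier (free_grp n)"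
    using assms by (intro order.trans[OF keys_frag_extend]) auto
qed

lemma augmentation_aug_act: "augmentation (aug_act n i a) = augmentation i * augmentation a"
proof -
  have "Poly_Mapping.keys i \<subseteq> UNIV" by simp
  then show ?thesis
    unfolding aug_act_def group_ring_simps
    by (induction i rule: free_Abelian_group_cases_induct)
      (simp_all add: frag_extend_diff augmentation_frag_extend_of algebra_simps)
qed

text \<open>The product rule \<open>fox_mult\<close>, extended bilinearly. On the augmentation ideal
  the second term vanishes, so there the derivatives are linear over the group ring; this makes the
  coordinates balanced.\<close>

lemma frag_extend_fox_act:
  assumes "Poly_Mapping.keys i \<subseteq> carrier (free_grp n)" "Poly_Mapping.keys a \<subseteq> carrier (free_grp n)"
  shows "frag_extend (fox n k) (aug_act n i a) =
    frag_extend (fox n k) i * frag_extend (chi n) a + frag_cmul (augmentation i) (frag_extend (fox n k) a)"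
  unfolding aug_act_def group_ring_simps
  using assms(1)
proof (induction i rule: free_Abelian_group_cases_induct)
  case (diff x y)
  then show ?case by (simp add: frag_extend_diff frag_cmul_diff_distrib algebra_simps)
next
  case (single g)
  show ?case using assms(2)
  proof (induction a rule: free_Abelian_group_cases_induct)
    case (diff x y)
    then show ?case by (simp add: frag_extend_diff algebra_simps)
  next
    case (single h)
    then show ?case using \<open>g \<in> carrier (free_grp n)\<close> by (simp add: fox_mult)
  qed simp
qed simp

section \<open>Coordinates and normal forms in the Long-Moody tensor product\<close>

definition aug_coord :: "nat \<Rightarrow> nat \<Rightarrow> (nat word set \<Rightarrow>\<^sub>0 int) \<times> laurent \<Rightarrow> laurent" where
  "aug_coord n j = (\<lambda>(i, v). frag_extend (fox n (Suc j)) i * v)"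

definition aug_basis :: "nat \<Rightarrow> nat \<Rightarrow> (nat word set \<Rightarrow>\<^sub>0 int)" where
  "aug_basis n j = frag_of (free_gen n (Suc j)) - frag_of \<one>\<^bsub>free_grp n\<^esub>"

lemma aug_basis_mem: "j < n \<Longrightarrow> aug_basis n j \<in> carrier (aug_module n)"
  unfolding aug_module_simps aug_basis_def
  by (auto dest!: subsetD[OF keys_diff])

lemma fox_aug_basis:
  "j < n \<Longrightarrow> frag_extend (fox n (Suc k)) (aug_basis n j) = (if j = k then 1 else 0)"
  by (simp add: aug_basis_def frag_extend_diff fox_gen fox_one)

lemma regular_module_simps:
  "carrier (regular_module R) = carrier R" "v \<oplus>\<^bsub>regular_module R\<^esub> w = v \<oplus>\<^bsub>R\<^esub> w"
  "r \<odot>\<^bsub>regular_module R\<^esub> v = r \<otimes>\<^bsub>R\<^esub> v"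
  by (simp_all add: regular_module_def)

lemma aug_balanced: "balanced_tensor (group_ring (free_grp n)) (aug_module n) (aug_act n)
    (regular_module laurent_ring) (char_act n)"
proof
  fix x y assume xy: "x \<in> carrier (aug_module n)" "y \<in> carrier (aug_module n)"
  show "x \<oplus>\<^bsub>aug_module n\<^esub> y \<in> carrier (aug_module n)"
    using xy keys_add[of x y] unfolding aug_module_simps by auto
next
  fix x a assume xa: "x \<in> carrier (aug_module n)" "a \<in> carrier (group_ring (free_grp n))"
  then show "aug_act n x a \<in> carrier (aug_module n)"
    unfolding aug_module_simps using keys_aug_act[of x n a]
    by (simp add: augmentation_aug_act group_ring_simps(1))
qed (simp_all add: regular_module_simps)

context
  fixes n :: nat
begin

interpretation B: balanced_tensor "group_ring (free_grp n)" "aug_module n" "aug_act n"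
  "regular_module laurent_ring" "char_act n"
  by (rule aug_balanced)

text \<open>The normal form: the sum of the tensors (x_{j+1} - 1) \<otimes> w_j over j < n.\<close>

definition basis_sum :: "(nat \<Rightarrow> laurent) \<Rightarrow> (nat word set \<Rightarrow>\<^sub>0 int) \<times> laurent \<Rightarrow>\<^sub>0 int" where
  "basis_sum w = (\<Sum>j<n. frag_of (aug_basis n j, w j))"

definition reducible :: "((nat word set \<Rightarrow>\<^sub>0 int) \<times> laurent \<Rightarrow>\<^sub>0 int) \<Rightarrow> bool" where
  "reducible c \<longleftrightarrow> (\<exists>w. c - basis_sum w \<in> B.K)"

lemma K_add_right: "i \<in> carrier (aug_module n) \<Longrightarrow> frag_of (i, v + w) - frag_of (i, v) - frag_of (i, w) \<in> B.K"
  using B.K_add_right[of i v w] by (simp add: regular_module_simps)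

lemma K_add_left: "i \<in> carrier (aug_module n) \<Longrightarrow> j \<in> carrier (aug_module n) \<Longrightarrow>
    frag_of (i + j, v) - frag_of (i, v) - frag_of (j, v) \<in> B.K"
  using B.K_add_left[of i j v] by (simp add: regular_module_simps aug_module_simps(2))

text \<open>The additivity relator for 0 + 0 is minus the claimed element.\<close>

lemma K_zero_right: "i \<in> carrier (aug_module n) \<Longrightarrow> frag_of (i, 0) \<in> B.K"
  using B.K_minus[OF K_add_right[of i 0 0]] by simp

lemma reducible_cong: "c - d \<in> B.K \<Longrightarrow> reducible d \<Longrightarrow> reducible c"
  unfolding reducible_def using B.K_add by fastforce

lemma reducible_diff:
  assumes "reducible c" "reducible d"
  shows "reducible (c - d)"
proof -
  obtain w u where w: "c - basis_sum w \<in> B.K" and u: "d - basis_sum u \<in> B.K"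
    using assms by (auto simp: reducible_def)
  \<comment> \<open>The relators speak of sums only, so subtraction in the second slot is expressed
    by writing \<open>w j\<close> as \<open>(w j - u j) + u j\<close>.\<close>
  have "(\<Sum>j<n. frag_of (aug_basis n j, (w j - u j) + u j) - frag_of (aug_basis n j, w j - u j)
      - frag_of (aug_basis n j, u j)) \<in> B.K"
    by (intro B.K_sum K_add_right aug_basis_mem) simp
  then have "basis_sum w - basis_sum (\<lambda>j. w j - u j) - basis_sum u \<in> B.K"
    by (simp add: basis_sum_def sum_subtractf)
  from B.K_add[OF B.K_diff[OF w u] this] show ?thesis
    unfolding reducible_def by (intro exI[of _ "\<lambda>j. w j - u j"]) (simp add: algebra_simps)
qed

lemma basis_sum_zero: "basis_sum (\<lambda>_. 0) \<in> B.K"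
  unfolding basis_sum_def by (intro B.K_sum K_zero_right aug_basis_mem) simp

lemma reducible_K: "c \<in> B.K \<Longrightarrow> reducible c"
  unfolding reducible_def using B.K_diff[OF _ basis_sum_zero] by blast

lemma reducible_add:
  assumes "reducible c" "reducible d"
  shows "reducible (c + d)"
  using reducible_diff[OF assms(1) reducible_diff[OF reducible_K[OF B.K_zero] assms(2)]] by simp

lemma reducible_basis: "j < n \<Longrightarrow> reducible (frag_of (aug_basis n j, v))"
proof -
  assume j: "j < n"
  have "basis_sum (\<lambda>k. if k = j then v else 0) =
      frag_of (aug_basis n j, v) + (\<Sum>k\<in>{..<n} - {j}. frag_of (aug_basis n k, 0))"
    unfolding basis_sum_def using j by (subst sum.remove[of _ j]) (auto intro!: sum.cong)
  moreover have "(\<Sum>k\<in>{..<n} - {j}. frag_of (aug_basis n k, 0)) \<in> B.K"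
    by (intro B.K_sum K_zero_right aug_basis_mem) simp
  ultimately show ?thesis
    unfolding reducible_def using B.K_minus
    by (intro exI[of _ "\<lambda>k. if k = j then v else 0"]) simp
qed

lemma aug_gen_mem: "x \<in> carrier (free_grp n) \<Longrightarrow>
    frag_of x - frag_of \<one>\<^bsub>free_grp n\<^esub> \<in> carrier (aug_module n)"
  unfolding aug_module_simps by (auto dest!: subsetD[OF keys_diff])

lemma aug_zero_mem: "0 \<in> carrier (aug_module n)"
  unfolding aug_module_simps by simp

lemma reducible_zero_left: "reducible (frag_of (0, v))"
  using B.K_minus[OF K_add_left[OF aug_zero_mem aug_zero_mem, of v]] by (intro reducible_K) simp

lemma K_add_left_eq:
  assumes "k = i + j" "i \<in> carrier (aug_module n)" "j \<in> carrier (aug_module n)"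
  shows "frag_of (k, v) - (frag_of (i, v) + frag_of (j, v)) \<in> B.K"
  using K_add_left[OF assms(2,3), of v] assms(1) by (simp add: algebra_simps)

text \<open>The group ring element \<open>a\<close> moves across the tensor sign and acts on
  \<open>v\<close>, which leaves a basis element on the left.\<close>

lemma reducible_basis_act:
  assumes "j < n" "Poly_Mapping.keys a \<subseteq> carrier (free_grp n)"
  shows "reducible (frag_of (aug_act n (aug_basis n j) a, v))"
  by (rule reducible_cong[OF B.K_balanced reducible_basis])
    (use assms aug_basis_mem in \<open>auto simp: group_ring_simps(1) regular_module_simps\<close>)

lemma aug_basis_act_mem:
  assumes "j < n" "y \<in> carrier (free_grp n)"
  shows "frag_of (free_gen n (Suc j) \<otimes>\<^bsub>free_grp n\<^esub> y) - frag_of y \<in> carrier (aug_module n)"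
  using assms unfolding aug_module_simps by (auto dest!: subsetD[OF keys_diff])

lemma aug_basis_act:
  assumes "y \<in> carrier (free_grp n)"
  shows "aug_act n (aug_basis n j) (frag_of y) = frag_of (free_gen n (Suc j) \<otimes>\<^bsub>free_grp n\<^esub> y) - frag_of y"
  using assms by (simp add: aug_act_def group_ring_simps aug_basis_def frag_extend_diff)

text \<open>Induction by x_s y - 1 = (x_s - 1) y + (y - 1), where the first summand is a basis
  element acted on by \<open>y\<close>.\<close>

lemma reducible_group_element:
  assumes "x \<in> carrier (free_grp n)"
  shows "reducible (frag_of (frag_of x - frag_of \<one>\<^bsub>free_grp n\<^esub>, v))"
  using assms
proof (induction x rule: F.presented_induct)
  case one
  then show ?case by (simp add: reducible_zero_left)
next
  case (gen s y)
  then obtain j where j: "s = Suc j" "j < n" by (cases s) auto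
  show ?case
  proof (rule reducible_cong[OF K_add_left_eq])
    show "reducible (frag_of (aug_act n (aug_basis n j) (frag_of y), v) +
        frag_of (frag_of y - frag_of \<one>\<^bsub>free_grp n\<^esub>, v))"
      using gen j by (intro reducible_add reducible_basis_act) auto
  qed (use gen j in \<open>auto simp: aug_basis_act aug_basis_act_mem aug_gen_mem\<close>)
next
  case (inv s y)
  then obtain j where j: "s = Suc j" "j < n" by (cases s) auto
  \<comment> \<open>For an inverse letter the same identity is read backwards: y = x_s z, so z - 1
    is the difference of y - 1 and (x_s - 1) z.\<close>
  define z where "z = inv\<^bsub>free_grp n\<^esub> (free_gen n s) \<otimes>\<^bsub>free_grp n\<^esub> y"
  have s: "free_gen n s \<in> carrier (free_grp n)" using inv(1) by auto
  have z: "z \<in> carrier (free_grp n)" using s inv(2) by (simp add: z_def)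
  have y: "y = free_gen n s \<otimes>\<^bsub>free_grp n\<^esub> z"
    using s inv(2) by (simp add: z_def inv_cancel_left)
  have "frag_of (frag_of y - frag_of \<one>\<^bsub>free_grp n\<^esub>, v) -
      (frag_of (aug_act n (aug_basis n j) (frag_of z), v) +
       frag_of (frag_of z - frag_of \<one>\<^bsub>free_grp n\<^esub>, v)) \<in> B.K"
    using z j y by (intro K_add_left_eq) (auto simp: aug_basis_act aug_basis_act_mem aug_gen_mem)
  from B.K_minus[OF this]
  have "frag_of (frag_of z - frag_of \<one>\<^bsub>free_grp n\<^esub>, v) -
      (frag_of (frag_of y - frag_of \<one>\<^bsub>free_grp n\<^esub>, v) -
       frag_of (aug_act n (aug_basis n j) (frag_of z), v)) \<in> B.K"
    by (simp add: algebra_simps)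
  then have "reducible (frag_of (frag_of z - frag_of \<one>\<^bsub>free_grp n\<^esub>, v))"
    using inv(3) j z by (elim reducible_cong) (auto intro!: reducible_diff reducible_basis_act)
  then show ?case by (simp add: z_def)
qed

lemma reducible_pure:
  assumes "i \<in> carrier (aug_module n)"
  shows "reducible (frag_of (i, v))"
proof -
  \<comment> \<open>Induction over the group ring leaves the augmentation ideal. The additive
    projection \<open>p\<close> returns to it, fixes its elements and sends a group element x to x -
    1.\<close>
  define p where "p a = a - frag_cmul (augmentation a) (frag_of \<one>\<^bsub>free_grp n\<^esub>)" for a
  have p_mem: "p a \<in> carrier (aug_module n)" if "Poly_Mapping.keys a \<subseteq> carrier (free_grp n)" for a
  proof -
    have "Poly_Mapping.keys (p a) \<subseteq> carrier (free_grp n)"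
      unfolding p_def using that keys_cmul[of "augmentation a" "frag_of \<one>\<^bsub>free_grp n\<^esub>"]
      by (intro order.trans[OF keys_diff]) auto
    then show ?thesis unfolding aug_module_simps by (simp add: p_def augmentation_cmul)
  qed
  have keys: "Poly_Mapping.keys i \<subseteq> carrier (free_grp n)" and aug: "augmentation i = 0"
    using assms unfolding aug_module_simps by auto
  have "reducible (frag_of (p i, v))"
    using keys
  proof (induction i rule: free_Abelian_group_cases_induct)
    case zero
    then show ?case by (simp add: p_def reducible_zero_left)
  next
    case (diff x y)
    have xy: "Poly_Mapping.keys (x - y) \<subseteq> carrier (free_grp n)"
      using diff(1,2) keys_diff[of x y] by blast
    have "p x = p (x - y) + p y"
      by (simp add: p_def frag_cmul_diff_distrib)
    then have "frag_of (p x, v) - (frag_of (p (x - y), v) + frag_of (p y, v)) \<in> B.K"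
      using diff(1,2) xy p_mem by (intro K_add_left_eq) auto
    from B.K_minus[OF this]
    have "frag_of (p (x - y), v) - (frag_of (p x, v) - frag_of (p y, v)) \<in> B.K"
      by (simp add: algebra_simps)
    then show ?case using diff by (elim reducible_cong) (auto intro: reducible_diff)
  next
    case (single a)
    then show ?case by (simp add: p_def reducible_group_element)
  qed
  then show ?thesis using aug by (simp add: p_def)
qed

lemma reducible_all:
  assumes "Poly_Mapping.keys c \<subseteq> carrier (aug_module n) \<times> carrier (regular_module laurent_ring)"
  shows "reducible c"
  using assms
proof (induction c rule: free_Abelian_group_cases_induct)
  case (single a)
  then show ?case by (cases a) (auto intro: reducible_pure)
qed (auto intro: reducible_diff reducible_K B.K_zero)

lemma keys_basis_sum: "Poly_Mapping.keys (basis_sum w) \<subseteq> carrier (aug_module n) \<times> carrier (regular_module laurent_ring)"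
  using sum_closed_free_Abelian_group[of "{..<n}" "\<lambda>j. frag_of (aug_basis n j, w j)" "carrier (aug_module n) \<times> UNIV"]
  by (simp add: basis_sum_def regular_module_simps aug_basis_mem)

lemma coord_basis_sum: "j < n \<Longrightarrow> frag_extend (aug_coord n j) (basis_sum w) = w j"
  by (simp add: basis_sum_def frag_extend_sum aug_coord_def fox_aug_basis if_distrib[of "\<lambda>x. x * _"] cong: if_cong)

text \<open>The tensor product is free of rank \<open>n\<close>: Fox derivatives give the
  coordinates, and every element reduces to a \<open>basis_sum\<close>.\<close>

lemma tensor_coords_aug: "tensor_coords (group_ring (free_grp n)) (aug_module n) (aug_act n)
    (regular_module laurent_ring) (char_act n) n (aug_coord n)"
proof
  fix j x a v
  assume x: "x \<in> carrier (aug_module n)" and a: "a \<in> carrier (group_ring (free_grp n))"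
  have "Poly_Mapping.keys x \<subseteq> carrier (free_grp n)" "augmentation x = 0"
    using x unfolding aug_module_simps by auto
  moreover have "Poly_Mapping.keys a \<subseteq> carrier (free_grp n)"
    using a by (simp add: group_ring_simps)
  ultimately show "aug_coord n j (aug_act n x a, v) = aug_coord n j (x, char_act n a v)"
    by (simp add: aug_coord_def frag_extend_fox_act char_act_eq mult.assoc)
next
  fix w :: "laurent vec" assume w: "w \<in> carrier_vec n"
  show "\<exists>c. Poly_Mapping.keys c \<subseteq> carrier (aug_module n) \<times> carrier (regular_module laurent_ring) \<and>
      vec n (\<lambda>j. frag_extend (aug_coord n j) c) = w"
    using w by (intro exI[of _ "basis_sum (\<lambda>j. w $ j)"] conjI keys_basis_sum)
      (auto simp: coord_basis_sum)
next
  fix c :: "(nat word set \<Rightarrow>\<^sub>0 int) \<times> laurent \<Rightarrow>\<^sub>0 int"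
  assume "Poly_Mapping.keys c \<subseteq> carrier (aug_module n) \<times> carrier (regular_module laurent_ring)"
  then obtain w where w: "c - basis_sum w \<in> B.K"
    using reducible_all by (auto simp: reducible_def)
  have "basis_sum w \<in> B.K" if "\<forall>j<n. frag_extend (aug_coord n j) (basis_sum w) = 0"
  proof -
    \<comment> \<open>The coordinates of a normal form are its coefficients; if they vanish, all its
      summands have second entry 0.\<close>
    have "basis_sum w = basis_sum (\<lambda>_. 0)"
      using that by (simp add: coord_basis_sum) (simp add: basis_sum_def)
    then show ?thesis by (simp add: basis_sum_zero)
  qed
  then show "\<exists>d. c - d \<in> B.K \<and> ((\<forall>j<n. frag_extend (aug_coord n j) d = 0) \<longrightarrow> d \<in> B.K)"
    using w by blast
qed (auto simp: aug_coord_def aug_module_simps(2) frag_extend_add distrib_left distrib_right regular_module_simps)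

end

section \<open>The Long-Moody construction\<close>

lemma long_moody_unit_repr:
  "long_moody n (unit_repr laurent_ring tvar) =
    (tensor_module (group_ring (free_grp n)) (aug_module n) (aug_act n) (regular_module laurent_ring) (char_act n),
     \<lambda>g. tensor_map (group_ring (free_grp n)) (aug_module n) (aug_act n) (regular_module laurent_ring) (char_act n)
       (frag_extend (\<lambda>x. frag_of (artin n g x)))
       (\<lambda>v\<in>carrier laurent_ring. unit_char laurent_ring tvar (shift n g) \<otimes>\<^bsub>laurent_ring\<^esub> v))"
  by (simp add: long_moody_def unit_repr_def Let_def aug_module_def aug_act_def[abs_def] char_act_def)

lemma vec_iso_long_moody:
  "vec_iso n (fst (long_moody n (unit_repr laurent_ring tvar))) (tensor_coords.tensor_iso n (aug_coord n))"
  unfolding long_moody_unit_repr fst_conv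
  by (rule vec_iso_tensor_module[OF tensor_coords_aug])
    (auto simp: aug_coord_def regular_module_simps mult.left_commute)

definition fox_frag :: "nat \<Rightarrow> (nat word set \<Rightarrow>\<^sub>0 int) \<Rightarrow> laurent vec" where
  "fox_frag n i = vec n (\<lambda>j. frag_extend (fox n (Suc j)) i)"

lemma fox_frag_carrier [simp]: "fox_frag n i \<in> carrier_vec n"
  by (simp add: fox_frag_def)

text \<open>The chain rule, extended linearly from group elements to the group ring.\<close>

lemma fox_frag_artin:
  assumes g: "g \<in> carrier (welded_braid n)" and i: "Poly_Mapping.keys i \<subseteq> carrier (free_grp n)"
  shows "fox_frag n (frag_extend (\<lambda>x. frag_of (artin n g x)) i) = burau_mat n g *\<^sub>v fox_frag n i"
  using i
proof (induction i rule: free_Abelian_group_cases_induct)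
  case zero
  have "fox_frag n 0 = 0\<^sub>v n" by (auto simp: fox_frag_def)
  then show ?case using burau_mat_carrier[OF g] by (auto intro!: eq_vecI)
next
  case (diff x y)
  have "fox_frag n (a - b) = fox_frag n a - fox_frag n b" for a b
    by (auto simp: fox_frag_def frag_extend_diff)
  then show ?case
    using diff by (simp add: frag_extend_diff mult_minus_distrib_mat_vec[OF burau_mat_carrier[OF g]])
next
  case (single x)
  then show ?case using fox_vec_artin[OF g, of x] by (simp add: fox_frag_def fox_vec_def)
qed

text \<open>The ideal factor is acted on by the Jacobian, the other factor by the character of the
  shifted braid, which equals the character of the braid itself. The scalar and the matrix then
  combine.\<close>

lemma long_moody_action:
  assumes g: "g \<in> carrier (welded_braid n)"
    and X: "X \<in> carrier (fst (long_moody n (unit_repr laurent_ring tvar)))"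
  shows "snd (long_moody n (unit_repr laurent_ring tvar)) g X
        \<in> carrier (fst (long_moody n (unit_repr laurent_ring tvar))) \<and>
      tensor_coords.tensor_iso n (aug_coord n) (snd (long_moody n (unit_repr laurent_ring tvar)) g X) =
      (unit_char laurent_ring tvar g \<cdot>\<^sub>m burau_mat n g) *\<^sub>v tensor_coords.tensor_iso n (aug_coord n) X"
proof -
  note B = burau_mat_carrier[OF g]
  let ?u = "unit_char laurent_ring tvar g"
  have coords: "vec n (\<lambda>j. aug_coord n j (i, v)) = v \<cdot>\<^sub>v fox_frag n i" for i v
    by (auto simp: aug_coord_def fox_frag_def mult.commute)
  have carrier: "carrier (tensor_module A M ra N la) = carrier (tensor_group A M ra N la)"
    for A M ra la and N :: "(laurent, laurent) module"
    by (simp add: tensor_module_def)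
  show ?thesis
    using X unfolding long_moody_unit_repr fst_conv snd_conv carrier
  proof (intro tensor_coords.tensor_iso_map[OF tensor_coords_aug])
    fix i assume i: "i \<in> carrier (aug_module n)"
    then show "frag_extend (\<lambda>x. frag_of (artin n g x)) i \<in> carrier (aug_module n)"
      using artin_closed[OF g] unfolding aug_module_simps augmentation_frag_extend_of
      by (intro conjI order.trans[OF keys_frag_extend]) auto
    fix v
    have keys: "Poly_Mapping.keys i \<subseteq> carrier (free_grp n)"
      using i unfolding aug_module_simps by simp
    have "(?u * v) \<cdot>\<^sub>v (burau_mat n g *\<^sub>v fox_frag n i) =
        (?u \<cdot>\<^sub>m burau_mat n g) *\<^sub>v (v \<cdot>\<^sub>v fox_frag n i)"
      using B by (simp add: smult_mat_mult_vec[OF B] mult_mat_smult_vec[OF B] smult_smult_assoc)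
    then show "vec n (\<lambda>j. aug_coord n j (frag_extend (\<lambda>x. frag_of (artin n g x)) i,
        (\<lambda>v\<in>carrier laurent_ring. unit_char laurent_ring tvar (shift n g) \<otimes>\<^bsub>laurent_ring\<^esub> v) v)) =
      (?u \<cdot>\<^sub>m burau_mat n g) *\<^sub>v vec n (\<lambda>j. aug_coord n j (i, v))"
      by (simp add: coords fox_frag_artin[OF g keys] unit_char_shift g)
  qed (use B in \<open>auto simp: regular_module_simps\<close>)
qed

text \<open>The isomorphism R \<otimes> W = W, a \<otimes> X to a X, followed by the coordinates of
  \<open>W\<close>. Its normal form is 1 \<otimes> X.\<close>

lemma tensor_coords_scalars:
  assumes W: "vec_iso n W \<phi>"
  shows "tensor_coords laurent_ring (regular_module laurent_ring)
    (\<lambda>v r. r \<odot>\<^bsub>regular_module laurent_ring\<^esub> v) W (\<lambda>r w. r \<odot>\<^bsub>W\<^esub> w) n (\<lambda>j (a, X). a * \<phi> X $ j)"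
proof -
  have bij: "bij_betw \<phi> (carrier W) (carrier_vec n)"
    and add: "\<And>x y. x \<in> carrier W \<Longrightarrow> y \<in> carrier W \<Longrightarrow> x \<oplus>\<^bsub>W\<^esub> y \<in> carrier W"
      "\<And>x y. x \<in> carrier W \<Longrightarrow> y \<in> carrier W \<Longrightarrow> \<phi> (x \<oplus>\<^bsub>W\<^esub> y) = \<phi> x + \<phi> y"
    and zeroW: "\<zero>\<^bsub>W\<^esub> \<in> carrier W" "\<phi> \<zero>\<^bsub>W\<^esub> = 0\<^sub>v n"
    and smult: "\<And>r x. x \<in> carrier W \<Longrightarrow> r \<odot>\<^bsub>W\<^esub> x \<in> carrier W"
      "\<And>r x. x \<in> carrier W \<Longrightarrow> \<phi> (r \<odot>\<^bsub>W\<^esub> x) = r \<cdot>\<^sub>v \<phi> x"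
    using W by (auto simp: vec_iso_def)
  have carr [simp]: "dim_vec (\<phi> x) = n" if "x \<in> carrier W" for x
    using bij that by (auto dest: bij_betwE)
  have eqI: "x = y" if "x \<in> carrier W" "y \<in> carrier W" "\<phi> x = \<phi> y" for x y
    using bij that by (auto simp: bij_betw_def inj_on_def)
  have zero_add: "\<zero>\<^bsub>W\<^esub> \<oplus>\<^bsub>W\<^esub> \<zero>\<^bsub>W\<^esub> = \<zero>\<^bsub>W\<^esub>"
    using zeroW by (intro eqI) (auto simp: add)
  interpret balanced_tensor laurent_ring "regular_module laurent_ring"
    "\<lambda>v r. r \<odot>\<^bsub>regular_module laurent_ring\<^esub> v" W "\<lambda>r w. r \<odot>\<^bsub>W\<^esub> w"
    by unfold_locales (auto simp: regular_module_simps add smult)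
  have normal: "\<exists>X\<in>carrier W. c - frag_of (1, X) \<in> K"
    if "Poly_Mapping.keys c \<subseteq> carrier (regular_module laurent_ring) \<times> carrier W" for c
    using that
  proof (induction c rule: free_Abelian_group_cases_induct)
    case zero
    \<comment> \<open>The normal form of 0 is the tensor of 1 with the zero of \<open>W\<close>; by
      the relator for 0 + 0 it lies in \<open>K\<close>.\<close>
    show ?case
      using K_add_right[of 1 "\<zero>\<^bsub>W\<^esub>" "\<zero>\<^bsub>W\<^esub>"] zeroW zero_add
      by (intro bexI[of _ "\<zero>\<^bsub>W\<^esub>"]) (auto simp: regular_module_simps)
  next
    case (diff c d)
    then obtain X Y where X: "X \<in> carrier W" "c - frag_of (1, X) \<in> K"
      and Y: "Y \<in> carrier W" "d - frag_of (1, Y) \<in> K" by auto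
    \<comment> \<open>This is X - Y, written with the scalar -1 because \<open>\<phi>\<close> is
      known to respect sums and multiples.\<close>
    define Z where "Z = X \<oplus>\<^bsub>W\<^esub> (-1) \<odot>\<^bsub>W\<^esub> Y"
    have Z: "Z \<in> carrier W" using X Y by (simp add: Z_def add smult)
    have "Z \<oplus>\<^bsub>W\<^esub> Y = X"
      using X Y Z by (intro eqI) (auto simp: Z_def add smult intro!: eq_vecI)
    then have "frag_of (1, X) - frag_of (1, Z) - frag_of (1, Y) \<in> K"
      using K_add_right[of 1 Z Y] Z Y by (simp add: regular_module_simps)
    from K_add[OF K_diff[OF X(2) Y(2)] this] show ?case
      using Z by (intro bexI[of _ Z]) (simp_all add: algebra_simps)
  next
    case (single p)
    then obtain a X where p: "p = (a, X)" "X \<in> carrier W" by auto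
    then show ?case
      using K_balanced[of 1 a X] smult(1)[of X a]
      by (intro bexI[of _ "a \<odot>\<^bsub>W\<^esub> X"]) (auto simp: regular_module_simps)
  qed
  show ?thesis
  proof
    fix w :: "laurent vec" assume w: "w \<in> carrier_vec n"
    then have "w \<in> \<phi> ` carrier W" using bij by (simp add: bij_betw_def)
    then obtain X where X: "X \<in> carrier W" "\<phi> X = w" by blast
    then show "\<exists>c. Poly_Mapping.keys c \<subseteq> carrier (regular_module laurent_ring) \<times> carrier W \<and>
        vec n (\<lambda>j. frag_extend (\<lambda>(a, X). a * \<phi> X $ j) c) = w"
      using w by (intro exI[of _ "frag_of (1, X)"]) (auto simp: regular_module_simps)
  next
    fix c :: "laurent \<times> 'a \<Rightarrow>\<^sub>0 int"
    assume "Poly_Mapping.keys c \<subseteq> carrier (regular_module laurent_ring) \<times> carrier W"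
    then obtain X where X: "X \<in> carrier W" "c - frag_of (1, X) \<in> K" using normal by blast
    have "frag_of (1, X) \<in> K" if "\<forall>j<n. frag_extend (\<lambda>(a, X). a * \<phi> X $ j) (frag_of (1, X)) = 0"
    proof -
      have "X = \<zero>\<^bsub>W\<^esub>"
        using that X zeroW by (intro eqI) (auto intro!: eq_vecI)
      then show ?thesis
        using K_minus[OF K_add_right[of 1 "\<zero>\<^bsub>W\<^esub>" "\<zero>\<^bsub>W\<^esub>"]] zeroW zero_add by (auto simp: regular_module_simps)
    qed
    then show "\<exists>d. c - d \<in> K \<and> ((\<forall>j<n. frag_extend (\<lambda>(a, X). a * \<phi> X $ j) d = 0) \<longrightarrow> d \<in> K)"
      using X by blast
  qed (auto simp: regular_module_simps add smult algebra_simps)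
qed

theorem theorem2p4:
  fixes n :: nat
  assumes "n \<ge> 3"
  shows "equivalent_reprs (welded_braid n) laurent_ring
    (twist laurent_ring (inv\<^bsub>laurent_ring\<^esub> tvar) (long_moody n (unit_repr laurent_ring tvar)))
    (burau n)"
proof -
  define W where "W = fst (long_moody n (unit_repr laurent_ring tvar))"
  define \<psi> where "\<psi> = snd (long_moody n (unit_repr laurent_ring tvar))"
  define \<phi> where "\<phi> = tensor_coords.tensor_iso n (aug_coord n)"
  have LM: "long_moody n (unit_repr laurent_ring tvar) = (W, \<psi>)"
    by (simp add: W_def \<psi>_def)
  have W: "vec_iso n W \<phi>"
    unfolding W_def \<phi>_def by (rule vec_iso_long_moody)
  have \<psi>: "\<psi> g X \<in> carrier W \<and>
      \<phi> (\<psi> g X) = (unit_char laurent_ring tvar g \<cdot>\<^sub>m burau_mat n g) *\<^sub>v \<phi> X"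
    if "g \<in> carrier (welded_braid n)" "X \<in> carrier W" for g X
    using long_moody_action[of g n X] that by (simp add: W_def \<psi>_def \<phi>_def)
  define \<beta> where "\<beta> = (\<lambda>j (a, X). a * \<phi> X $ j)"
  interpret tensor_coords laurent_ring "regular_module laurent_ring"
    "\<lambda>v r. r \<odot>\<^bsub>regular_module laurent_ring\<^esub> v" W "\<lambda>r w. r \<odot>\<^bsub>W\<^esub> w" n \<beta>
    unfolding \<beta>_def by (rule tensor_coords_scalars[OF W])
  have \<phi>_carr: "\<phi> X \<in> carrier_vec n" if "X \<in> carrier W" for X
    using W that by (auto simp: vec_iso_def dest: bij_betwE)
  have smult: "r \<odot>\<^bsub>W\<^esub> X \<in> carrier W" "\<phi> (r \<odot>\<^bsub>W\<^esub> X) = r \<cdot>\<^sub>v \<phi> X" if "X \<in> carrier W" for r X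
    using W that by (auto simp: vec_iso_def)
  let ?V = "tensor_module laurent_ring (regular_module laurent_ring)
    (\<lambda>v r. r \<odot>\<^bsub>regular_module laurent_ring\<^esub> v) W (\<lambda>r w. r \<odot>\<^bsub>W\<^esub> w)"
  let ?\<rho> = "\<lambda>g. tensor_map laurent_ring (regular_module laurent_ring)
    (\<lambda>v r. r \<odot>\<^bsub>regular_module laurent_ring\<^esub> v) W (\<lambda>r w. r \<odot>\<^bsub>W\<^esub> w)
    (\<lambda>v\<in>carrier laurent_ring. unit_char laurent_ring tinv g \<otimes>\<^bsub>laurent_ring\<^esub> v) (\<psi> g)"
  have "vec_iso n ?V tensor_iso"
    by (rule vec_iso_tensor_module[OF tensor_coords_axioms])
      (auto simp: \<beta>_def smult mult.left_commute carrier_vecD[OF \<phi>_carr])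
  moreover have action: "?\<rho> g X \<in> carrier ?V \<and> tensor_iso (?\<rho> g X) = burau_mat n g *\<^sub>v tensor_iso X"
    if g: "g \<in> carrier (welded_braid n)" and X: "X \<in> carrier ?V" for g X
  proof -
    note B = burau_mat_carrier[OF g]
    have coords: "vec n (\<lambda>j. \<beta> j (a, Y)) = a \<cdot>\<^sub>v \<phi> Y" if "Y \<in> carrier W" for a Y
      using \<phi>_carr[OF that] by (auto simp: \<beta>_def)
    have carrier: "carrier ?V = carrier T" by (simp add: tensor_module_def)
    show ?thesis
      unfolding carrier
    proof (rule tensor_iso_map)
      fix a Y assume Y: "Y \<in> carrier W"
      \<comment> \<open>The first factor contributes the character of \<open>tinv\<close>, the
        Long-Moody action that of \<open>tvar\<close>; their product is 1 and the bare Burau matrix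
        remains.\<close>
      have "(unit_char laurent_ring tinv g * a) \<cdot>\<^sub>v \<phi> (\<psi> g Y) =
          (unit_char laurent_ring tinv g * unit_char laurent_ring tvar g * a) \<cdot>\<^sub>v (burau_mat n g *\<^sub>v \<phi> Y)"
        using \<psi>[OF g Y] \<phi>_carr[OF Y]
        by (simp add: smult_mat_mult_vec[OF B] smult_smult_assoc mult_ac)
      also have "\<dots> = burau_mat n g *\<^sub>v (a \<cdot>\<^sub>v \<phi> Y)"
        using \<phi>_carr[OF Y] by (simp add: unit_char_inverse[OF g] mult_mat_smult_vec[OF B])
      finally show "vec n (\<lambda>j. \<beta> j
          ((\<lambda>v\<in>carrier laurent_ring. unit_char laurent_ring tinv g \<otimes>\<^bsub>laurent_ring\<^esub> v) a, \<psi> g Y)) =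
        burau_mat n g *\<^sub>v vec n (\<lambda>j. \<beta> j (a, Y))"
        using \<psi>[OF g Y] by (simp add: coords Y)
    qed (use B \<psi>[OF g] X carrier in \<open>auto simp: regular_module_simps\<close>)
  qed
  moreover have "?\<rho> g \<in> extensional (carrier ?V)" for g
    by (simp add: tensor_map_def tensor_module_def)
  ultimately have "equivalent_reprs (welded_braid n) laurent_ring (?V, ?\<rho>)
      (module_vec TYPE(laurent) n, \<lambda>g. \<lambda>v\<in>carrier_vec n. burau_mat n g *\<^sub>v v)"
    by (intro equivalent_reprs_vec_iso[OF W.is_group burau_mat_hom]) auto
  then show ?thesis
    unfolding LM by (simp add: twist_def tensor_repr_def unit_repr_def burau_def inv_laurent_tvar)
qed

end
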